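(* Let $H$ be a graded connected Hopf algebra over a field of characteristic zero that is a polynomial algebra with monomial basis $\mathcal{B}$. For $b\in\mathcal{B}$ with factorization into generators $b=c_1c_2\cdots c_l$, set $g_b:=e(c_1)e(c_2)\cdots e(c_l)$. Then for every positive integer $a$, $g_b$ is an eigenvector of $\Psi^a$ of eigenvalue $a^{l}$, and it satisfies $$g_b=b+\sum_{b'\in\mathcal{B},\ b\to b',\ b'\neq b}g_b(b')\,b'=b+\sum_{b'\in\mathcal{B},\ l(b')>l(b)}g_b(b')\,b'.$$ Hence $\{g_b: b\in\mathcal{B}_n\}$ is a basis of $H_n$ consisting of eigenvectors of $\Psi^a$, and the multiplicity of the eigenvalue $a^l$ on $H_n$ is the coefficient of $x^ny^l$ in $\prod_{i\ge1}(1-yx^i)^{-d_i}$, where $d_i$ is the number of generators of degree $i$.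
   Context: Graded connected Hopf algebra: $H=\bigoplus_{n\ge0}H_n$ with $H_0$ the ground field, each $H_n$ finite-dimensional, product and coproduct respecting the grading, counit zero on positive degrees. $m^{[a]}$ is the $a$-fold product, $\Delta^{[a]}$ the $a$-fold coproduct ($\Delta^{[1]}=\mathrm{id}$, $\Delta^{[a]}=(\mathrm{id}^{\otimes(a-2)}\otimes\Delta)\Delta^{[a-1]}$), and $\Psi^a=m^{[a]}\Delta^{[a]}$. "Polynomial algebra with monomial basis $\mathcal{B}$": as an algebra $H=k[c_1,c_2,\dots]$ is polynomial on finitely or countably many homogeneous generators $c_i$ of positive degree, and $\mathcal{B}$ is the set of monomials in them. $\mathcal{B}_n$ = elements of $\mathcal{B}$ of degree $n$. The length $l(b)$ of $b\in\mathcal{B}$ is the number of generator factors (with multiplicity) of $b$. For $b,b'\in\mathcal{B}$, write $b\to b'$ if $b'$ has nonzero coefficient in $\Psi^a(b)$ (expanded in $\mathcal{B}$) for some positive integer $a$. For $g\in H$ and $b'\in\mathcal{B}$, $g(b')$ denotes the coefficient of $b'$ in $g$. Let $\bar\Delta(x)=\Delta(x)-1\otimes x-x\otimes 1$ for $x$ of positive degree, $\bar\Delta^{[1]}=\mathrm{id}$, $\bar\Delta^{[a]}=(\mathrm{id}^{\otimes(a-2)}\otimes\bar\Delta)\bar\Delta^{[a-1]}$. The (first) Eulerian idempotent is $e(x)=\sum_{a\ge1}\frac{(-1)^{a-1}}{a}m^{[a]}\bar\Delta^{[a]}(x)$ for $x$ of positive degree (a finite sum), and $e\equiv 0$ on 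$H_0$.
   Formalization: The multiplicity of the eigenvalue a^l on H_n is stated for a ≥ 2 only; for a = 1 all a^l coincide and the literal claim fails, so there only the number of b in B_n of length l is shown to equal the coefficient. *)

theory Defs
  imports
    "HOL-Analysis.Analysis"
    "HOL-Library.Poly_Mapping"
    "HOL-Library.Multiset"
    "HOL-Library.Product_Plus"
    "HOL-Computational_Algebra.Formal_Power_Series"
begin

section \<open>Free vector spaces and their tensor products\<close>

text \<open>
  \<open>'m \<Rightarrow>\<^sub>0 'k\<close> is the vector space over \<open>'k\<close> with basis the elements of \<open>'m\<close>.
  When \<open>'m\<close> is a commutative monoid (written additively), the multiplication of
  \<open>HOL-Library.Poly_Mapping\<close> makes it the monoid algebra. For \<open>'m = 'g multiset\<close>, the free
  commutative monoid on \<open>'g\<close>, this is the polynomial algebra with one variable for each element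
  of \<open>'g\<close>: a multiset is a monomial, multiset union is the product of monomials and \<open>{#}\<close> is the
  monomial 1.

  The tensor product of the spaces with bases \<open>'m\<close> and \<open>'n\<close> is the space with basis
  \<open>'m \<times> 'n\<close>, the pair \<open>(u, v)\<close> standing for \<open>u \<otimes> v\<close>. With the componentwise monoid structure on
  pairs, the product of the monoid algebra on \<open>'m \<times> 'n\<close> is the usual product of the tensor
  product algebra, \<open>(u \<otimes> v) (u' \<otimes> v') = u u' \<otimes> v v'\<close>. In the same way, the \<open>a\<close>-fold tensor power
  has as basis the lists of length \<open>a\<close>.
\<close>

definition fscale :: "'k::field \<Rightarrow> ('m \<Rightarrow>\<^sub>0 'k) \<Rightarrow> ('m \<Rightarrow>\<^sub>0 'k)" where
  "fscale c p = Poly_Mapping.map ((*) c) p"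

lemma lookup_fscale [simp]: "Poly_Mapping.lookup (fscale c p) m = c * Poly_Mapping.lookup p m"
  by (simp add: fscale_def Poly_Mapping.map.rep_eq when_def)

global_interpretation fmod: vector_space "fscale :: 'k::field \<Rightarrow> ('m \<Rightarrow>\<^sub>0 'k) \<Rightarrow> ('m \<Rightarrow>\<^sub>0 'k)"
  by unfold_locales (auto intro!: poly_mapping_eqI simp: lookup_add algebra_simps)

definition mon :: "'m \<Rightarrow> ('m \<Rightarrow>\<^sub>0 'k::field)" where
  "mon m = Poly_Mapping.single m 1"

text \<open>The subspace with basis \<open>S\<close>.\<close>

definition free_on :: "'m set \<Rightarrow> ('m \<Rightarrow>\<^sub>0 'k::field) set" where
  "free_on S = {p. Poly_Mapping.keys p \<subseteq> S}"

text \<open>The linear map with the given values on basis elements.\<close>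

definition lin_ext :: "('m \<Rightarrow> ('n \<Rightarrow>\<^sub>0 'k::field)) \<Rightarrow> ('m \<Rightarrow>\<^sub>0 'k) \<Rightarrow> ('n \<Rightarrow>\<^sub>0 'k)" where
  "lin_ext f p = (\<Sum>m\<in>Poly_Mapping.keys p. fscale (Poly_Mapping.lookup p m) (f m))"

definition tensor :: "('m \<Rightarrow>\<^sub>0 'k::field) \<Rightarrow> ('n \<Rightarrow>\<^sub>0 'k) \<Rightarrow> ('m \<times> 'n \<Rightarrow>\<^sub>0 'k)" where
  "tensor x y = lin_ext (\<lambda>u. lin_ext (\<lambda>v. mon (u, v)) y) x"

text \<open>The tensor product \<open>f \<otimes> g\<close> of linear maps.\<close>

definition tensor_map ::
  "(('m \<Rightarrow>\<^sub>0 'k::field) \<Rightarrow> ('p \<Rightarrow>\<^sub>0 'k)) \<Rightarrow> (('n \<Rightarrow>\<^sub>0 'k) \<Rightarrow> ('q \<Rightarrow>\<^sub>0 'k)) \<Rightarrow>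
    ('m \<times> 'n \<Rightarrow>\<^sub>0 'k) \<Rightarrow> ('p \<times> 'q \<Rightarrow>\<^sub>0 'k)" where
  "tensor_map f g = lin_ext (\<lambda>(u, v). tensor (f (mon u)) (g (mon v)))"

text \<open>The canonical isomorphism from \<open>(U \<otimes> V) \<otimes> W\<close> to \<open>U \<otimes> (V \<otimes> W)\<close>.\<close>

definition tensor_assoc :: "(('m \<times> 'n) \<times> 'p \<Rightarrow>\<^sub>0 'k::field) \<Rightarrow> ('m \<times> ('n \<times> 'p) \<Rightarrow>\<^sub>0 'k)" where
  "tensor_assoc = lin_ext (\<lambda>((u, v), w). mon (u, (v, w)))"

text \<open>\<open>f \<otimes> id\<close> and \<open>id \<otimes> f\<close> for a linear form \<open>f\<close>, with \<open>k \<otimes> V\<close> and \<open>V \<otimes> k\<close> identified with \<open>V\<close>.\<close>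

definition form_left :: "(('m \<Rightarrow>\<^sub>0 'k::field) \<Rightarrow> 'k) \<Rightarrow> ('m \<times> 'n \<Rightarrow>\<^sub>0 'k) \<Rightarrow> ('n \<Rightarrow>\<^sub>0 'k)" where
  "form_left f = lin_ext (\<lambda>(u, v). fscale (f (mon u)) (mon v))"

definition form_right :: "(('n \<Rightarrow>\<^sub>0 'k::field) \<Rightarrow> 'k) \<Rightarrow> ('m \<times> 'n \<Rightarrow>\<^sub>0 'k) \<Rightarrow> ('m \<Rightarrow>\<^sub>0 'k)" where
  "form_right f = lin_ext (\<lambda>(u, v). fscale (f (mon v)) (mon u))"

text \<open>The product \<open>x \<otimes> y \<mapsto> x y\<close>.\<close>

definition mult_map :: "('m \<times> 'm \<Rightarrow>\<^sub>0 'k::field) \<Rightarrow> ('m::comm_monoid_add \<Rightarrow>\<^sub>0 'k)" where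
  "mult_map = lin_ext (\<lambda>(u, v). mon u * mon v)"

definition linear_map_on ::
  "('m \<Rightarrow>\<^sub>0 'k::field) set \<Rightarrow> ('k \<Rightarrow> 'v \<Rightarrow> 'v::ab_group_add) \<Rightarrow> (('m \<Rightarrow>\<^sub>0 'k) \<Rightarrow> 'v) \<Rightarrow> bool" where
  "linear_map_on V sc f \<longleftrightarrow>
     (\<forall>x\<in>V. \<forall>y\<in>V. f (x + y) = f x + f y) \<and> (\<forall>c. \<forall>x\<in>V. f (fscale c x) = sc c (f x))"


section \<open>Graded connected Hopf algebras that are polynomial algebras\<close>

text \<open>
  The generators are the elements of \<open>gens\<close> (possibly empty) and \<open>monomials gens\<close> is the monomial
  basis. The degree of a monomial is the sum of the degrees of its factors, its length is \<open>size\<close>.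
\<close>

definition monomials :: "'g set \<Rightarrow> 'g multiset set" where
  "monomials gens = {b. set_mset b \<subseteq> gens}"

definition mdeg :: "('g \<Rightarrow> nat) \<Rightarrow> 'g multiset \<Rightarrow> nat" where
  "mdeg deg b = (\<Sum>c\<in>#b. deg c)"

definition monomials_deg :: "'g set \<Rightarrow> ('g \<Rightarrow> nat) \<Rightarrow> nat \<Rightarrow> 'g multiset set" where
  "monomials_deg gens deg n = {b \<in> monomials gens. mdeg deg b = n}"

definition poly_alg :: "'g set \<Rightarrow> ('g multiset \<Rightarrow>\<^sub>0 'k::field) set" where
  "poly_alg gens = free_on (monomials gens)"

definition poly_alg_deg :: "'g set \<Rightarrow> ('g \<Rightarrow> nat) \<Rightarrow> nat \<Rightarrow> ('g multiset \<Rightarrow>\<^sub>0 'k::field) set" where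
  "poly_alg_deg gens deg n = free_on (monomials_deg gens deg n)"

text \<open>
  A graded connected Hopf algebra structure with coproduct \<open>cop\<close> and counit \<open>eps\<close>, on the
  polynomial algebra on homogeneous generators of positive degree. That the degree 0 part is the
  ground field and that the product respects the grading is built into the model. The maps are
  only constrained on the algebra itself, not on polynomials involving elements outside \<open>gens\<close>.
\<close>

locale polynomial_hopf_algebra =
  fixes gens :: "'g set"
    and deg :: "'g \<Rightarrow> nat"
    and cop :: "('g multiset \<Rightarrow>\<^sub>0 'k::field) \<Rightarrow> ('g multiset \<times> 'g multiset \<Rightarrow>\<^sub>0 'k)"
    and eps :: "('g multiset \<Rightarrow>\<^sub>0 'k) \<Rightarrow> 'k"
  assumes countable_gens: "countable gens"
    and deg_pos: "c \<in> gens \<Longrightarrow> deg c > 0"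
    and finite_dim:
      "\<exists>S. finite S \<and> fmod.span S = (poly_alg_deg gens deg n :: ('g multiset \<Rightarrow>\<^sub>0 'k) set)"
    and cop_linear: "linear_map_on (poly_alg gens) fscale cop"
    and cop_graded:
      "x \<in> poly_alg_deg gens deg n \<Longrightarrow>
        cop x \<in> free_on (\<Union>i\<le>n. monomials_deg gens deg i \<times> monomials_deg gens deg (n - i))"
    and cop_mult: "x \<in> poly_alg gens \<Longrightarrow> y \<in> poly_alg gens \<Longrightarrow> cop (x * y) = cop x * cop y"
    and cop_one: "cop 1 = 1"
    and eps_linear: "linear_map_on (poly_alg gens) (*) eps"
    and eps_graded: "n > 0 \<Longrightarrow> x \<in> poly_alg_deg gens deg n \<Longrightarrow> eps x = 0"
    and eps_mult: "x \<in> poly_alg gens \<Longrightarrow> y \<in> poly_alg gens \<Longrightarrow> eps (x * y) = eps x * eps y"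
    and eps_one: "eps 1 = 1"
    and coassoc:
      "x \<in> poly_alg gens \<Longrightarrow>
        tensor_assoc (tensor_map cop id (cop x)) = tensor_map id cop (cop x)"
    and counit_left: "x \<in> poly_alg gens \<Longrightarrow> form_left eps (cop x) = x"
    and counit_right: "x \<in> poly_alg gens \<Longrightarrow> form_right eps (cop x) = x"
    and antipode:
      "\<exists>S. linear_map_on (poly_alg gens) fscale S \<and> S ` poly_alg gens \<subseteq> poly_alg gens \<and>
        (\<forall>x\<in>poly_alg gens. mult_map (tensor_map S id (cop x)) = fscale (eps x) 1 \<and>
                           mult_map (tensor_map id S (cop x)) = fscale (eps x) 1)"


section \<open>Hopf powers and the Eulerian idempotent\<close>

text \<open>\<open>id \<otimes> \<dots> \<otimes> id \<otimes> D\<close>, where \<open>D\<close> acts on the last tensor factor.\<close>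

definition apply_last ::
  "(('m \<Rightarrow>\<^sub>0 'k::field) \<Rightarrow> ('m \<times> 'm \<Rightarrow>\<^sub>0 'k)) \<Rightarrow> ('m list \<Rightarrow>\<^sub>0 'k) \<Rightarrow> ('m list \<Rightarrow>\<^sub>0 'k)" where
  "apply_last D =
     lin_ext (\<lambda>w. lin_ext (\<lambda>(u, v). mon (butlast w @ [u, v])) (D (mon (last w))))"

text \<open>The iterates of \<open>D = \<Delta>\<close> and of the reduced coproduct; only used for \<open>a \<ge> 1\<close>.\<close>

fun iter_cop ::
  "(('m \<Rightarrow>\<^sub>0 'k::field) \<Rightarrow> ('m \<times> 'm \<Rightarrow>\<^sub>0 'k)) \<Rightarrow> nat \<Rightarrow> ('m \<Rightarrow>\<^sub>0 'k) \<Rightarrow> ('m list \<Rightarrow>\<^sub>0 'k)" where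
  "iter_cop D 0 x = 0"
| "iter_cop D (Suc 0) x = lin_ext (\<lambda>u. mon [u]) x"
| "iter_cop D (Suc (Suc a)) x = apply_last D (iter_cop D (Suc a) x)"

definition iter_mult :: "('m list \<Rightarrow>\<^sub>0 'k::field) \<Rightarrow> ('m::comm_monoid_add \<Rightarrow>\<^sub>0 'k)" where
  "iter_mult = lin_ext (\<lambda>w. \<Prod>u\<leftarrow>w. mon u)"

definition hopf_power ::
  "(('m \<Rightarrow>\<^sub>0 'k::field) \<Rightarrow> ('m \<times> 'm \<Rightarrow>\<^sub>0 'k)) \<Rightarrow> nat \<Rightarrow> ('m \<Rightarrow>\<^sub>0 'k) \<Rightarrow> ('m::comm_monoid_add \<Rightarrow>\<^sub>0 'k)" where
  "hopf_power cop a x = iter_mult (iter_cop cop a x)"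

definition reduced_cop ::
  "(('m \<Rightarrow>\<^sub>0 'k::field) \<Rightarrow> ('m \<times> 'm \<Rightarrow>\<^sub>0 'k)) \<Rightarrow> ('m::comm_monoid_add \<Rightarrow>\<^sub>0 'k) \<Rightarrow> ('m \<times> 'm \<Rightarrow>\<^sub>0 'k)" where
  "reduced_cop cop x = cop x - tensor 1 x - tensor x 1"

text \<open>
  The component of \<open>x\<close> of degree 0 is its constant term, so \<open>y\<close> below is the positive degree part of
  \<open>x\<close> and \<open>eulerian\<close> is the linear map given by the series in positive degrees and vanishing
  in degree 0. The sum is restricted to its nonzero terms because a HOL sum over an infinite set is 0.
\<close>

definition eulerian ::
  "(('m \<Rightarrow>\<^sub>0 'k::field) \<Rightarrow> ('m \<times> 'm \<Rightarrow>\<^sub>0 'k)) \<Rightarrow> ('m \<Rightarrow>\<^sub>0 'k) \<Rightarrow> ('m::comm_monoid_add \<Rightarrow>\<^sub>0 'k)" where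
  "eulerian cop x =
    (let y = x - Poly_Mapping.single 0 (Poly_Mapping.lookup x 0) in
      \<Sum>a\<in>{a. a \<ge> 1 \<and> iter_cop (reduced_cop cop) a y \<noteq> 0}.
        fscale ((-1) ^ (a - 1) / of_nat a) (iter_mult (iter_cop (reduced_cop cop) a y)))"

definition eigen_monomial ::
  "(('g multiset \<Rightarrow>\<^sub>0 'k::field) \<Rightarrow> ('g multiset \<times> 'g multiset \<Rightarrow>\<^sub>0 'k)) \<Rightarrow>
    'g multiset \<Rightarrow> ('g multiset \<Rightarrow>\<^sub>0 'k)" where
  "eigen_monomial cop b = (\<Prod>c\<in>#b. eulerian cop (mon {#c#}))"

text \<open>The relation \<open>b \<rightarrow> b'\<close>.\<close>

definition leads_to ::
  "(('g multiset \<Rightarrow>\<^sub>0 'k::field) \<Rightarrow> ('g multiset \<times> 'g multiset \<Rightarrow>\<^sub>0 'k)) \<Rightarrow>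
    'g multiset \<Rightarrow> 'g multiset \<Rightarrow> bool" where
  "leads_to cop b b' \<longleftrightarrow> (\<exists>a\<ge>1. Poly_Mapping.lookup (hopf_power cop a (mon b)) b' \<noteq> 0)"

definition eigenspace ::
  "('m \<Rightarrow>\<^sub>0 'k::field) set \<Rightarrow> (('m \<Rightarrow>\<^sub>0 'k) \<Rightarrow> ('m \<Rightarrow>\<^sub>0 'k)) \<Rightarrow> 'k \<Rightarrow> ('m \<Rightarrow>\<^sub>0 'k) set" where
  "eigenspace V f c = {x \<in> V. f x = fscale c x}"

definition eigenvector ::
  "('m \<Rightarrow>\<^sub>0 'k::field) set \<Rightarrow> (('m \<Rightarrow>\<^sub>0 'k) \<Rightarrow> ('m \<Rightarrow>\<^sub>0 'k)) \<Rightarrow> 'k \<Rightarrow> ('m \<Rightarrow>\<^sub>0 'k) \<Rightarrow> bool" where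
  "eigenvector V f c x \<longleftrightarrow> x \<in> eigenspace V f c \<and> x \<noteq> 0"

text \<open>
  The product of \<open>(1 - y x\<^sup>i)\<^bsup>-d\<^sub>i\<^esup>\<close> over \<open>i \<ge> 1\<close>, as a power series in \<open>x\<close> (the outer variable) whose
  coefficients are power series in \<open>y\<close> (the inner variable); the product converges \<open>x\<close>-adically,
  which is the topology of \<open>fps\<close>. The index of \<open>prodinf\<close> starts at 0, hence the shift.
\<close>

definition num_gens :: "'g set \<Rightarrow> ('g \<Rightarrow> nat) \<Rightarrow> nat \<Rightarrow> nat" where
  "num_gens gens deg i = card {c \<in> gens. deg c = i}"

definition gen_product :: "(nat \<Rightarrow> nat) \<Rightarrow> rat fps fps" where
  "gen_product d = prodinf (\<lambda>i. inverse ((1 - fps_const fps_X * fps_X ^ Suc i) ^ d (Suc i)))"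

end

theory Submission
  imports Defs
begin

text \<open>
  Since \<open>\<Psi>\<^sup>a\<close> is the \<open>a\<close>-th convolution power of \<open>id = \<eta>\<epsilon> + J\<close>, the binomial theorem writes
  \<open>\<Psi>\<^sup>a(c)\<close> as a polynomial in \<open>a\<close> with coefficients in \<open>H\<close>; it has no constant term, and its linear
  coefficient is the Eulerian idempotent \<open>e(c)\<close>. As \<open>H\<close> is commutative, \<open>\<Psi>\<^sup>a\<close> is multiplicative, so
  for a monomial \<open>b\<close> of length \<open>l\<close> the polynomial \<open>\<Psi>\<^sup>a(b)\<close> in \<open>a\<close> has lowest-order term \<open>g\<^sub>b a\<^sup>l\<close>.
  Comparing coefficients in \<open>\<Psi>\<^sup>a(\<Psi>\<^sup>c(b)) = \<Psi>\<^bsup>ac\<^esup>(b)\<close> gives \<open>\<Psi>\<^sup>a(g\<^sub>b) = a\<^sup>l g\<^sub>b\<close>, and a monomial with a nonzero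
  coefficient in \<open>g\<^sub>b\<close> must occur in \<open>\<Psi>\<^sup>a(b)\<close> for some \<open>a\<close>. Finally \<open>e(c) - c\<close> only involves
  products of at least two elements of positive degree, so the \<open>g\<^sub>b\<close> are unitriangular with respect
  to length.
\<close>

abbreviation "lookup \<equiv> Poly_Mapping.lookup"
abbreviation "keys \<equiv> Poly_Mapping.keys"

section \<open>Linear extensions\<close>

lemma lookup_mon: "lookup (mon u) v = (if u = v then 1 else 0)"
  by (simp add: mon_def lookup_single when_def)

lemma keys_mon [simp]: "keys (mon u :: 'm \<Rightarrow>\<^sub>0 'k::field) = {u}"
  by (simp add: mon_def)

lemma mon_add: "mon (u + v) = (mon u * mon v :: 'm::comm_monoid_add \<Rightarrow>\<^sub>0 'k::field)"
  by (simp add: mon_def mult_single)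

lemma mon_zero: "mon 0 = (1 :: 'm::comm_monoid_add \<Rightarrow>\<^sub>0 'k::field)"
  by (simp add: mon_def)

lemma fscale_eq_mult: "fscale c p = Poly_Mapping.single (0::'m::comm_monoid_add) (c::'k::field) * p"
  by (simp add: fscale_def mult_map_scale_conv_mult)

lemma fscale_mult_left: "fscale c p * q = fscale c (p * q :: 'm::comm_monoid_add \<Rightarrow>\<^sub>0 'k::field)"
  by (simp add: fscale_eq_mult mult.assoc)

lemma fscale_mult_right: "p * fscale c q = fscale c (p * q :: 'm::comm_monoid_add \<Rightarrow>\<^sub>0 'k::field)"
  by (simp add: fscale_eq_mult mult.left_commute)

lemma fscale_mult:
  "fscale c p * fscale d q = fscale (c * d) (p * q :: 'm::comm_monoid_add \<Rightarrow>\<^sub>0 'k::field)"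
  by (simp add: fscale_mult_left fscale_mult_right)

lemma of_nat_mult_eq_fscale:
  "of_nat n * (p :: 'm::comm_monoid_add \<Rightarrow>\<^sub>0 'k::field) = fscale (of_nat n) p"
  by (simp add: fscale_eq_mult)

lemma of_nat_power_mult_eq_fscale:
  "of_nat n ^ l * (p :: 'm::comm_monoid_add \<Rightarrow>\<^sub>0 'k::field) = fscale (of_nat n ^ l) p"
  by (metis of_nat_mult_eq_fscale of_nat_power)

lemma keys_fscale_subset: "keys (fscale c p) \<subseteq> keys p"
  by (auto simp: in_keys_iff)

lemma lin_ext_superset:
  assumes "finite T" "keys x \<subseteq> T"
  shows "lin_ext f x = (\<Sum>u\<in>T. fscale (lookup x u) (f u))"
  unfolding lin_ext_def using assms
  by (intro sum.mono_neutral_left) (auto simp: in_keys_iff)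

lemma lin_ext_mon [simp]: "lin_ext f (mon u) = f u"
  by (simp add: lin_ext_def lookup_mon)

lemma lin_ext_zero [simp]: "lin_ext f 0 = 0"
  by (simp add: lin_ext_def)

lemma lin_ext_add: "lin_ext f (x + y) = lin_ext f x + lin_ext f y"
proof -
  have "finite (keys x \<union> keys y)" by simp
  moreover have "keys (x + y) \<subseteq> keys x \<union> keys y" by (rule Poly_Mapping.keys_add)
  ultimately show ?thesis
    by (simp add: lin_ext_superset[of "keys x \<union> keys y"] lookup_add fmod.scale_left_distrib
        sum.distrib)
qed

lemma lin_ext_fscale: "lin_ext f (fscale c x) = fscale c (lin_ext f x)"
proof -
  have "lin_ext f (fscale c x) = (\<Sum>u\<in>keys x. fscale (lookup (fscale c x) u) (f u))"
    by (rule lin_ext_superset) (auto simp: keys_fscale_subset)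
  then show ?thesis by (simp add: lin_ext_def fmod.scale_sum_right)
qed

lemma lin_ext_diff: "lin_ext f (x - y) = lin_ext f x - lin_ext f y"
  by (metis add_diff_cancel_right' diff_add_cancel lin_ext_add)

lemma lin_ext_sum: "lin_ext f (\<Sum>i\<in>I. g i) = (\<Sum>i\<in>I. lin_ext f (g i))"
  by (induction I rule: infinite_finite_induct) (auto simp: lin_ext_add)

lemma lin_ext_cong: "(\<And>u. u \<in> keys x \<Longrightarrow> f u = g u) \<Longrightarrow> lin_ext f x = lin_ext g x"
  by (auto simp: lin_ext_def intro!: sum.cong)

lemma lin_ext_lin_ext: "lin_ext f (lin_ext g x) = lin_ext (\<lambda>u. lin_ext f (g u)) x"
  by (simp add: lin_ext_def[of g] lin_ext_sum lin_ext_fscale)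
    (simp add: lin_ext_def)

lemma expand_mon: "(\<Sum>u\<in>keys x. fscale (lookup x u) (mon u)) = x"
  by (rule poly_mapping_eqI) (auto simp: lookup_sum lookup_mon in_keys_iff if_distrib cong: if_cong)

lemma lin_ext_mon_self: "lin_ext mon x = x"
  by (simp add: lin_ext_def expand_mon)

lemma lin_ext_fun_add: "lin_ext (\<lambda>u. f u + g u) x = lin_ext f x + lin_ext g x"
  by (simp add: lin_ext_def fmod.scale_right_distrib sum.distrib)

lemma lin_ext_fun_diff: "lin_ext (\<lambda>u. f u - g u) x = lin_ext f x - lin_ext g x"
  by (simp add: lin_ext_def fmod.scale_right_diff_distrib sum_subtractf)

lemma lin_ext_fun_sum: "lin_ext (\<lambda>u. \<Sum>i\<in>I. f i u) x = (\<Sum>i\<in>I. lin_ext (f i) x)"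
  by (induction I rule: infinite_finite_induct)
    (auto simp: lin_ext_fun_add, auto simp: lin_ext_def)

lemma lin_ext_fun_mult_left:
  "lin_ext (\<lambda>u. a * f u) x = (a :: 'm::comm_monoid_add \<Rightarrow>\<^sub>0 'k::field) * lin_ext f x"
  by (simp add: lin_ext_def fscale_mult_right sum_distrib_left)

lemma lin_ext_fun_mult_right:
  "lin_ext (\<lambda>u. f u * a) x = lin_ext f x * (a :: 'm::comm_monoid_add \<Rightarrow>\<^sub>0 'k::field)"
  by (simp add: lin_ext_def fscale_mult_left sum_distrib_right)

lemma lin_ext_tensor: "lin_ext h (tensor x y) = lin_ext (\<lambda>u. lin_ext (\<lambda>v. h (u, v)) y) x"
  by (simp add: tensor_def lin_ext_lin_ext)

text \<open>Multiplicativity is asked only on the supports, because the maps in question are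
  controlled only on monomials in \<open>gens\<close>.\<close>

lemma lin_ext_mult:
  fixes x y :: "'m::comm_monoid_add \<Rightarrow>\<^sub>0 'k::field" and f :: "'m \<Rightarrow> ('n::comm_monoid_add \<Rightarrow>\<^sub>0 'k)"
  assumes "\<And>u v. u \<in> keys x \<Longrightarrow> v \<in> keys y \<Longrightarrow> f (u + v) = f u * f v"
  shows "lin_ext f (x * y) = lin_ext f x * lin_ext f y"
proof -
  have "x * y = (\<Sum>u\<in>keys x. \<Sum>v\<in>keys y. fscale (lookup x u * lookup y v) (mon (u + v)))"
    by (subst (1) expand_mon[of x, symmetric], subst (1) expand_mon[of y, symmetric])
      (simp only: sum_product fscale_mult mon_add)
  then have "lin_ext f (x * y) =
      (\<Sum>u\<in>keys x. \<Sum>v\<in>keys y. fscale (lookup x u * lookup y v) (f (u + v)))"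
    by (simp only: lin_ext_sum lin_ext_fscale lin_ext_mon)
  also have "\<dots> = (\<Sum>u\<in>keys x. \<Sum>v\<in>keys y. fscale (lookup x u) (f u) * fscale (lookup y v) (f v))"
    by (intro sum.cong) (simp_all only: assms fscale_mult)
  also have "\<dots> = lin_ext f x * lin_ext f y"
    by (simp only: lin_ext_def sum_product)
  finally show ?thesis .
qed

section \<open>Subspaces spanned by sets of basis elements\<close>

lemma subspace_free_on: "fmod.subspace (free_on S)"
  unfolding fmod.subspace_def free_on_def
  using Poly_Mapping.keys_add keys_fscale_subset by (fastforce dest!: subsetD)

lemmas free_on_zero = fmod.subspace_0[OF subspace_free_on]
  and free_on_add = fmod.subspace_add[OF subspace_free_on]
  and free_on_fscale = fmod.subspace_scale[OF subspace_free_on]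
  and free_on_sum = fmod.subspace_sum[OF subspace_free_on]

lemma mon_in_free_on [simp]: "mon u \<in> free_on S \<longleftrightarrow> u \<in> S"
  by (simp add: free_on_def)

lemma free_on_mono: "x \<in> free_on S \<Longrightarrow> S \<subseteq> T \<Longrightarrow> x \<in> free_on T"
  by (auto simp: free_on_def)

lemma free_onD: "x \<in> free_on S \<Longrightarrow> u \<in> keys x \<Longrightarrow> u \<in> S"
  by (auto simp: free_on_def)

lemma free_on_lin_ext:
  "(\<And>u. u \<in> keys x \<Longrightarrow> f u \<in> free_on S) \<Longrightarrow> lin_ext f x \<in> free_on S"
  unfolding lin_ext_def by (intro free_on_sum free_on_fscale) auto

lemma free_on_mult:
  assumes "x \<in> free_on S" "y \<in> free_on T" "\<And>u v. u \<in> S \<Longrightarrow> v \<in> T \<Longrightarrow> u + v \<in> U"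
  shows "x * y \<in> free_on U"
  using keys_mult[of x y] assms unfolding free_on_def by blast

lemma span_mon: "fmod.span (mon ` S) = free_on S"
proof
  show "fmod.span (mon ` S) \<subseteq> (free_on S :: ('a \<Rightarrow>\<^sub>0 'b) set)"
    by (rule fmod.span_minimal) (auto simp: subspace_free_on)
  show "free_on S \<subseteq> (fmod.span (mon ` S) :: ('a \<Rightarrow>\<^sub>0 'b) set)"
  proof
    fix x :: "'a \<Rightarrow>\<^sub>0 'b" assume "x \<in> free_on S"
    then have "(\<Sum>u\<in>keys x. fscale (lookup x u) (mon u)) \<in> fmod.span (mon ` S)"
      by (intro fmod.span_sum fmod.span_scale fmod.span_base) (auto dest: free_onD)
    then show "x \<in> fmod.span (mon ` S)" by (simp add: expand_mon)
  qed
qed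

text \<open>Finitely many vectors involve only finitely many basis elements. This turns
  \<open>finite_dim\<close> into finiteness of the set of monomials of each degree.\<close>

lemma finite_if_span_eq_free_on:
  fixes B :: "('m \<Rightarrow>\<^sub>0 'k::field) set"
  assumes "finite B" "fmod.span B = (free_on S :: ('m \<Rightarrow>\<^sub>0 'k) set)"
  shows "finite S"
proof -
  have "fmod.span B \<subseteq> free_on (\<Union>b\<in>B. keys b)"
  proof (rule fmod.span_minimal)
    show "B \<subseteq> free_on (\<Union>b\<in>B. keys b)" unfolding free_on_def by blast
  qed (rule subspace_free_on)
  then have "mon u \<in> (free_on (\<Union>b\<in>B. keys b) :: ('m \<Rightarrow>\<^sub>0 'k) set)" if "u \<in> S" for u
    using that assms(2) by (metis mon_in_free_on subsetD)
  then have "S \<subseteq> (\<Union>b\<in>B. keys b)" unfolding mon_in_free_on ..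
  then show ?thesis by (rule finite_subset) (use assms in auto)
qed

subsection \<open>Unitriangular families\<close>

text \<open>In the application \<open>T\<close> consists of the monomials of one degree,
  \<open>s\<close> is the length and \<open>f\<close> is \<open>eigen_monomial\<close>.\<close>

locale unitriangular_family =
  fixes T :: "'m set" and s :: "'m \<Rightarrow> nat" and f :: "'m \<Rightarrow> ('m \<Rightarrow>\<^sub>0 'k::field)"
  assumes finite_T: "finite T"
    and remainder: "b \<in> T \<Longrightarrow> f b - mon b \<in> free_on {c \<in> T. s c > s b}"
begin

lemma in_free_on: "b \<in> T \<Longrightarrow> f b \<in> free_on T"
  using free_on_add[OF free_on_mono[OF remainder, of b T], of "mon b"] by auto

lemma lookup_eq: "b \<in> T \<Longrightarrow> s c \<le> s b \<Longrightarrow> lookup (f b) c = (if b = c then 1 else 0)"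
proof -
  assume "b \<in> T" "s c \<le> s b"
  then have "c \<notin> keys (f b - mon b)" using free_onD[OF remainder, of b c] by auto
  then show ?thesis by (simp add: in_keys_iff lookup_minus lookup_mon)
qed

text \<open>Induction on \<open>s b\<close>: in the coefficient of \<open>b\<close>, the members
  \<open>f c\<close> with \<open>s c < s b\<close> drop out by induction, and among the others only
  \<open>f b\<close> contains \<open>b\<close>.\<close>

lemma coefficients_zero:
  assumes "(\<Sum>b\<in>T. fscale (\<alpha> b) (f b)) = 0" "b \<in> T"
  shows "\<alpha> b = 0"
  using \<open>b \<in> T\<close>
proof (induction "s b" arbitrary: b rule: less_induct)
  case (less b)
  have "(\<Sum>c\<in>T. \<alpha> c * lookup (f c) b) = lookup (\<Sum>c\<in>T. fscale (\<alpha> c) (f c)) b"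
    by (simp add: lookup_sum)
  also have "\<dots> = 0" by (simp add: assms)
  also have "(\<Sum>c\<in>T. \<alpha> c * lookup (f c) b) = (\<Sum>c\<in>T. if c = b then \<alpha> b else 0)"
  proof (intro sum.cong)
    fix c assume "c \<in> T"
    then show "\<alpha> c * lookup (f c) b = (if c = b then \<alpha> b else 0)"
      using less.hyps[of c] lookup_eq[of c b] by (cases "s b \<le> s c") auto
  qed simp
  also have "\<dots> = \<alpha> b" using less finite_T by simp
  finally show ?case .
qed

lemma inj: "inj_on f T"
proof (rule inj_onI, rule ccontr)
  fix b c assume bc: "b \<in> T" "c \<in> T" "f b = f c" "b \<noteq> c"
  \<comment> \<open>Independence of the image set says nothing about repeated values, so
    \<open>f b - f c = 0\<close> is read as a relation indexed by \<open>T\<close> with coefficients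
    1 and -1.\<close>
  define \<alpha> where "\<alpha> x = (if x = b then 1 else 0) - (if x = c then 1 else 0 :: 'k)" for x
  have "(\<Sum>x\<in>T. fscale (\<alpha> x) (f x)) =
      (\<Sum>x\<in>T. (if x = b then f b else 0) - (if x = c then f c else 0))"
    by (intro sum.cong) (auto simp: \<alpha>_def)
  also have "\<dots> = 0" using bc finite_T by (simp add: sum_subtractf)
  finally have "\<alpha> b = 0" using coefficients_zero bc by blast
  with bc show False by (simp add: \<alpha>_def)
qed

lemma independent: "fmod.independent (f ` T)"
proof (rule fmod.independent_if_scalars_zero)
  fix \<alpha> x assume "(\<Sum>x\<in>f ` T. fscale (\<alpha> x) x) = 0" "x \<in> f ` T"
  then show "\<alpha> x = 0"
    using coefficients_zero[of "\<alpha> \<circ> f"] by (auto simp: sum.reindex[OF inj])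
qed (simp add: finite_T)

text \<open>Downward induction on \<open>s b\<close>: the remainder \<open>f b - mon b\<close>
  involves only monomials with larger \<open>s\<close>, already known to lie in the span.\<close>

lemma mon_in_span: "b \<in> T \<Longrightarrow> mon b \<in> fmod.span (f ` T)"
proof (induction "Max (s ` T) - s b" arbitrary: b rule: less_induct)
  case (less b)
  have "free_on {c \<in> T. s c > s b} \<subseteq> fmod.span (f ` T)"
    unfolding span_mon[symmetric]
  proof (rule fmod.span_minimal)
    show "mon ` {c \<in> T. s c > s b} \<subseteq> fmod.span (f ` T)"
    proof safe
      fix c assume c: "c \<in> T" "s b < s c"
      then have "s c \<le> Max (s ` T)" by (simp add: finite_T)
      with c show "mon c \<in> fmod.span (f ` T)" by (intro less) auto
    qed
  qed simp
  with remainder[OF less.prems] have "f b - mon b \<in> fmod.span (f ` T)" by blast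
  moreover have "f b \<in> fmod.span (f ` T)" using less.prems by (simp add: fmod.span_base)
  ultimately show ?case using fmod.span_diff by fastforce
qed

lemma span_eq: "fmod.span (f ` T) = free_on T"
proof
  show "fmod.span (f ` T) \<subseteq> free_on T"
    by (rule fmod.span_minimal) (auto simp: subspace_free_on in_free_on)
  show "free_on T \<subseteq> fmod.span (f ` T)"
    unfolding span_mon[symmetric] by (rule fmod.span_minimal) (auto simp: mon_in_span)
qed

lemma card_indices: "card (f ` U) = card U" if "U \<subseteq> T"
  using that inj by (meson card_image inj_on_subset)

text \<open>The coefficients of an eigenvector for \<open>q ^ l\<close> vanish outside length \<open>l\<close>, since the powers
  of \<open>q\<close> are distinct.\<close>

lemma dim_eigenspace:
  assumes "inj (\<lambda>n. q ^ n)"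
    and eigen: "\<And>b. b \<in> T \<Longrightarrow> lin_ext \<phi> (f b) = fscale (q ^ s b) (f b)"
  shows "fmod.dim (eigenspace (free_on T) (lin_ext \<phi>) (q ^ l)) = card {b \<in> T. s b = l}"
proof -
  let ?U = "{b \<in> T. s b = l}"
  have "eigenspace (free_on T) (lin_ext \<phi>) (q ^ l) = fmod.span (f ` ?U)"
  proof
    show "fmod.span (f ` ?U) \<subseteq> eigenspace (free_on T) (lin_ext \<phi>) (q ^ l)"
      by (rule fmod.span_minimal)
        (auto simp: eigenspace_def in_free_on eigen fmod.subspace_def lin_ext_add lin_ext_fscale
          free_on_add free_on_fscale free_on_zero fmod.scale_right_distrib mult.commute)
    show "eigenspace (free_on T) (lin_ext \<phi>) (q ^ l) \<subseteq> fmod.span (f ` ?U)"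
    proof
      fix x assume "x \<in> eigenspace (free_on T) (lin_ext \<phi>) (q ^ l)"
      then have x: "x \<in> fmod.span (f ` T)" "lin_ext \<phi> x = fscale (q ^ l) x"
        by (auto simp: eigenspace_def span_eq)
      from x(1) obtain \<beta> where "x = (\<Sum>v\<in>f ` T. fscale (\<beta> v) v)"
        using fmod.span_finite[of "f ` T"] finite_T by auto
      then have xs: "x = (\<Sum>b\<in>T. fscale (\<beta> (f b)) (f b))"
        by (simp add: sum.reindex[OF inj])
      have "(\<Sum>b\<in>T. fscale (\<beta> (f b) * (q ^ s b - q ^ l)) (f b)) = lin_ext \<phi> x - fscale (q ^ l) x"
        unfolding xs lin_ext_sum fmod.scale_sum_right sum_subtractf[symmetric]
        by (intro sum.cong)
          (auto simp: lin_ext_fscale eigen fmod.scale_left_diff_distrib algebra_simps)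
      then have "\<beta> (f b) * (q ^ s b - q ^ l) = 0" if "b \<in> T" for b
        using coefficients_zero[where \<alpha> = "\<lambda>b. \<beta> (f b) * (q ^ s b - q ^ l)"] x that by simp
      then have "\<beta> (f b) = 0" if "b \<in> T" "s b \<noteq> l" for b
        using that injD[OF assms(1)] by fastforce
      then have "x = (\<Sum>b\<in>?U. fscale (\<beta> (f b)) (f b))"
        unfolding xs using finite_T by (intro sum.mono_neutral_right) auto
      also have "\<dots> \<in> fmod.span (f ` ?U)"
        by (intro fmod.span_sum fmod.span_scale fmod.span_base imageI)
      finally show "x \<in> fmod.span (f ` ?U)" .
    qed
  qed
  moreover have "fmod.independent (f ` ?U)"
    by (rule fmod.independent_mono[OF independent]) auto
  ultimately show ?thesis by (simp add: fmod.dim_eq_card_independent card_indices)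
qed

end

section \<open>Degrees of monomials\<close>

lemma mdeg_zero [simp]: "mdeg deg 0 = 0"
  by (simp add: mdeg_def)

lemma mdeg_add: "mdeg deg (b + c) = mdeg deg b + mdeg deg c"
  by (simp add: mdeg_def)

lemma mdeg_single: "mdeg deg {#c#} = deg c"
  by (simp add: mdeg_def)

lemma mdeg_add_mset [simp]: "mdeg deg (add_mset c b) = deg c + mdeg deg b"
  by (simp add: mdeg_def)

text \<open>Every factor contributes at least 1 to the degree. This bound makes the convolution
  series terminate.\<close>

lemma size_le_mdeg_if_pos:
  assumes "\<And>c. c \<in># b \<Longrightarrow> deg c > 0"
  shows "size b \<le> mdeg deg b"
  using assms
proof (induction b)
  case (add c b)
  then have "deg c > 0" "size b \<le> mdeg deg b" by auto
  then show ?case by simp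
qed simp

lemma monomials_zero [simp]: "0 \<in> monomials gens"
  by (simp add: monomials_def)

lemma monomials_add [simp]: "b + c \<in> monomials gens \<longleftrightarrow> b \<in> monomials gens \<and> c \<in> monomials gens"
  by (simp add: monomials_def)

section \<open>Convolution\<close>

text \<open>A linear map is represented by its values on basis elements. \<open>D\<close> is a
  parameter because both the full and the reduced coproduct are used.\<close>

definition conv ::
  "(('m \<Rightarrow>\<^sub>0 'k::field) \<Rightarrow> ('m \<times> 'm \<Rightarrow>\<^sub>0 'k)) \<Rightarrow> ('m \<Rightarrow> ('n::comm_monoid_add \<Rightarrow>\<^sub>0 'k)) \<Rightarrow>
    ('m \<Rightarrow> ('n \<Rightarrow>\<^sub>0 'k)) \<Rightarrow> 'm \<Rightarrow> ('n \<Rightarrow>\<^sub>0 'k)" where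
  "conv D f g u = lin_ext (\<lambda>(v, w). f v * g w) (D (mon u))"

lemma conv_cong:
  assumes "\<And>v w. (v, w) \<in> keys (D (mon u)) \<Longrightarrow> f v = f' v \<and> g w = g' w"
  shows "conv D f g u = conv D f' g' u"
  unfolding conv_def using assms by (intro lin_ext_cong) auto

lemma conv_diff_left: "conv D (\<lambda>v. f v - f' v) g u = conv D f g u - conv D f' g u"
  by (simp add: conv_def case_prod_unfold left_diff_distrib lin_ext_fun_diff)

lemma conv_sum_right: "conv D f (\<lambda>w. \<Sum>i\<in>I. g i w) u = (\<Sum>i\<in>I. conv D f (g i) u)"
  by (simp add: conv_def case_prod_unfold sum_distrib_left lin_ext_fun_sum)

lemma conv_mult_right: "conv D f (\<lambda>w. c * g w) u = c * conv D f g u"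
  by (simp add: conv_def case_prod_unfold mult.left_commute lin_ext_fun_mult_left)

text \<open>Applying \<open>D\<close> to the last tensor factor and then multiplying the first factors among
  themselves and with \<open>f\<close> of the last one amounts to replacing \<open>f\<close> by its convolution with the
  identity. So the iterates of \<open>D\<close> are accessible without coassociativity.\<close>

lemma lin_ext_apply_last:
  fixes f :: "'m \<Rightarrow> ('m::comm_monoid_add \<Rightarrow>\<^sub>0 'k::field)"
  shows "lin_ext (\<lambda>w. (\<Prod>u\<leftarrow>butlast w. mon u) * f (last w)) (apply_last D x) =
    lin_ext (\<lambda>w. (\<Prod>u\<leftarrow>butlast w. mon u) * conv D mon f (last w)) x"
  by (simp add: apply_last_def lin_ext_lin_ext case_prod_unfold conv_def butlast_append
      lin_ext_fun_mult_left mult.assoc)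

lemma lin_ext_iter_cop:
  fixes f :: "'m \<Rightarrow> ('m::comm_monoid_add \<Rightarrow>\<^sub>0 'k::field)"
  shows "lin_ext (\<lambda>w. (\<Prod>u\<leftarrow>butlast w. mon u) * f (last w)) (iter_cop D (Suc a) x) =
    lin_ext ((conv D mon ^^ a) f) x"
  by (induction a arbitrary: f)
    (simp_all add: lin_ext_lin_ext lin_ext_apply_last funpow_swap1)

lemma iter_cop_nonempty: "[] \<notin> keys (iter_cop D (Suc a) x)"
proof -
  have "iter_cop D (Suc a) x \<in> free_on {w. w \<noteq> []}"
    by (cases a) (auto simp: apply_last_def case_prod_unfold intro!: free_on_lin_ext)
  then show ?thesis by (auto dest: free_onD)
qed

lemma iter_mult_iter_cop:
  fixes x :: "'m::comm_monoid_add \<Rightarrow>\<^sub>0 'k::field"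
  shows "iter_mult (iter_cop D (Suc a) x) = lin_ext ((conv D mon ^^ a) mon) x"
proof -
  have "(\<Prod>u\<leftarrow>w. mon u) = (\<Prod>u\<leftarrow>butlast w. mon u) * (mon (last w) :: 'm \<Rightarrow>\<^sub>0 'k)"
    if "w \<noteq> []" for w :: "'m list"
    using that by (induction w) auto
  then show ?thesis
    unfolding iter_mult_def lin_ext_iter_cop[symmetric] using iter_cop_nonempty[of D a x]
    by (intro lin_ext_cong) (metis (full_types))
qed

text \<open>The convolution unit \<open>\<eta>\<epsilon>\<close> and \<open>J = id - \<eta>\<epsilon>\<close>.\<close>

definition conv_one :: "'m::comm_monoid_add \<Rightarrow> ('n::comm_monoid_add \<Rightarrow>\<^sub>0 'k::field)" where
  "conv_one u = (if u = 0 then 1 else 0)"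

definition aug :: "'m::comm_monoid_add \<Rightarrow> ('m \<Rightarrow>\<^sub>0 'k::field)" where
  "aug u = mon u - conv_one u"

text \<open>Starting from the convolution unit gives a meaning to exponent 0, where the binomial
  induction begins; for \<open>a \<ge> 1\<close> the result is \<open>\<Psi>\<^sup>a\<close> on
  monomials in \<open>gens\<close>.\<close>

definition id_power ::
  "(('m \<Rightarrow>\<^sub>0 'k::field) \<Rightarrow> ('m \<times> 'm \<Rightarrow>\<^sub>0 'k)) \<Rightarrow> nat \<Rightarrow> 'm::comm_monoid_add \<Rightarrow> ('m \<Rightarrow>\<^sub>0 'k)" where
  "id_power D a = (conv D mon ^^ a) conv_one"

definition aug_power ::
  "(('m \<Rightarrow>\<^sub>0 'k::field) \<Rightarrow> ('m \<times> 'm \<Rightarrow>\<^sub>0 'k)) \<Rightarrow> nat \<Rightarrow> 'm::comm_monoid_add \<Rightarrow> ('m \<Rightarrow>\<^sub>0 'k)" where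
  "aug_power D a = (conv D aug ^^ a) conv_one"

lemma id_power_0 [simp]: "id_power D 0 = conv_one"
  and id_power_Suc: "id_power D (Suc a) = conv D mon (id_power D a)"
  by (simp_all add: id_power_def)

lemma aug_power_0 [simp]: "aug_power D 0 = conv_one"
  and aug_power_Suc: "aug_power D (Suc a) = conv D aug (aug_power D a)"
  by (simp_all add: aug_power_def)

section \<open>The Hopf algebra axioms as rules for convolution\<close>

context polynomial_hopf_algebra
begin

abbreviation "S \<equiv> monomials gens"
abbreviation "H \<equiv> monomials_deg gens deg"

lemma H_iff: "u \<in> H n \<longleftrightarrow> u \<in> S \<and> mdeg deg u = n"
  by (auto simp: monomials_deg_def)

lemma size_le_mdeg: "u \<in> S \<Longrightarrow> size u \<le> mdeg deg u"
  using deg_pos by (intro size_le_mdeg_if_pos) (auto simp: monomials_def)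

lemma mdeg_pos: "u \<in> S \<Longrightarrow> u \<noteq> 0 \<Longrightarrow> mdeg deg u > 0"
  using size_le_mdeg[of u] by (simp add: nonempty_has_size)

lemma finite_H: "finite (H n)"
  using finite_dim[of n] finite_if_span_eq_free_on unfolding poly_alg_deg_def by blast

text \<open>The axioms hold only on the algebra generated by \<open>gens\<close>; by the grading,
  all tensor factors of a coproduct stay in \<open>S\<close>, where the axioms apply again.\<close>

lemma cop_keys:
  assumes "u \<in> S" "(v, w) \<in> keys (cop (mon u))"
  shows "v \<in> S" "w \<in> S" "mdeg deg v + mdeg deg w = mdeg deg u"
proof -
  have "mon u \<in> (poly_alg_deg gens deg (mdeg deg u) :: ('g multiset \<Rightarrow>\<^sub>0 'k) set)"
    using assms(1) by (simp add: poly_alg_deg_def H_iff)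
  from free_onD[OF cop_graded[OF this] assms(2)]
  show "v \<in> S" "w \<in> S" "mdeg deg v + mdeg deg w = mdeg deg u"
    by (auto simp: H_iff)
qed

lemma conv_cop_cong:
  assumes "u \<in> S" "\<And>v. v \<in> S \<Longrightarrow> f v = f' v" "\<And>w. w \<in> S \<Longrightarrow> g w = g' w"
  shows "conv cop f g u = conv cop f' g' u"
  using assms(2,3) cop_keys(1,2)[OF assms(1)] by (intro conv_cong) auto

text \<open>Connectedness: 1 is the only monomial of degree 0, so \<open>eps\<close> agrees with the
  projection to the constant term used in \<open>conv_one\<close>.\<close>

lemma eps_mon: "u \<in> S \<Longrightarrow> eps (mon u) = (if u = 0 then 1 else 0)"
  using eps_one eps_graded[of "mdeg deg u" "mon u"] mdeg_pos[of u]
  by (auto simp: mon_zero poly_alg_deg_def H_iff)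

lemma mon_in_poly_alg: "mon u \<in> poly_alg gens \<longleftrightarrow> u \<in> S"
  by (simp add: poly_alg_def)

lemma conv_one_left: "u \<in> S \<Longrightarrow> conv cop conv_one g u = g u"
proof -
  assume u: "u \<in> S"
  have "conv cop conv_one g u = lin_ext (\<lambda>(v, w). fscale (eps (mon v)) (g w)) (cop (mon u))"
    unfolding conv_def using cop_keys[OF u]
    by (intro lin_ext_cong) (auto simp: eps_mon conv_one_def)
  also have "\<dots> = lin_ext g (form_left eps (cop (mon u)))"
    by (simp add: form_left_def lin_ext_lin_ext case_prod_unfold lin_ext_fscale)
  finally show ?thesis using u by (simp add: counit_left mon_in_poly_alg)
qed

lemma conv_one_right: "u \<in> S \<Longrightarrow> conv cop f conv_one u = f u"
proof -
  assume u: "u \<in> S"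
  have "conv cop f conv_one u = lin_ext (\<lambda>(v, w). fscale (eps (mon w)) (f v)) (cop (mon u))"
    unfolding conv_def using cop_keys[OF u]
    by (intro lin_ext_cong) (auto simp: eps_mon conv_one_def)
  also have "\<dots> = lin_ext f (form_right eps (cop (mon u)))"
    by (simp add: form_right_def lin_ext_lin_ext case_prod_unfold lin_ext_fscale)
  finally show ?thesis using u by (simp add: counit_right mon_in_poly_alg)
qed

lemma conv_assoc:
  assumes "u \<in> S"
  shows "conv cop (conv cop f g) h u = conv cop f (conv cop g h) u"
proof -
  let ?F = "\<lambda>(p, q, t). f p * g q * h t"
  have "conv cop (conv cop f g) h u = lin_ext ?F (tensor_assoc (tensor_map cop id (cop (mon u))))"
    by (simp add: conv_def tensor_assoc_def tensor_map_def lin_ext_lin_ext lin_ext_tensor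
        case_prod_unfold lin_ext_fun_mult_right)
  also have "\<dots> = lin_ext ?F (tensor_map id cop (cop (mon u)))"
    using assms by (simp add: coassoc mon_in_poly_alg)
  also have "\<dots> = conv cop f (conv cop g h) u"
    by (simp add: conv_def tensor_map_def lin_ext_lin_ext lin_ext_tensor
        case_prod_unfold lin_ext_fun_mult_left mult.assoc)
  finally show ?thesis .
qed

lemma conv_zero: "conv cop f g 0 = f 0 * g 0"
proof -
  have "cop (mon 0) = mon (0, 0)"
    by (metis cop_one mon_zero zero_prod_def)
  then show ?thesis by (simp add: conv_def)
qed

text \<open>The coproduct is an algebra morphism, and commutativity of the product allows the two
  middle factors to be exchanged.\<close>

lemma conv_add_multiplicative:
  assumes f: "\<And>v w. v \<in> S \<Longrightarrow> w \<in> S \<Longrightarrow> f (v + w) = f v * f w"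
    and g: "\<And>v w. v \<in> S \<Longrightarrow> w \<in> S \<Longrightarrow> g (v + w) = g v * g w"
    and uv: "u \<in> S" "v \<in> S"
  shows "conv cop f g (u + v) = conv cop f g u * conv cop f g v"
proof -
  have "cop (mon (u + v)) = cop (mon u) * cop (mon v)"
    using uv by (simp add: mon_add cop_mult mon_in_poly_alg)
  then show ?thesis
    using cop_keys[OF uv(1)] cop_keys[OF uv(2)] unfolding conv_def
    by (simp only:) (intro lin_ext_mult, auto simp: f g mult_ac)
qed

text \<open>One rule for tracking supports by degree and by length. The sets depend on the tensor
  factors, whose degrees vary while their sum is fixed.\<close>

lemma conv_free_on:
  assumes "u \<in> S" "\<And>v. v \<in> S \<Longrightarrow> f v \<in> free_on (V v)" "\<And>v. v \<in> S \<Longrightarrow> g v \<in> free_on (W v)"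
    and "\<And>v w b c. v \<in> S \<Longrightarrow> w \<in> S \<Longrightarrow> mdeg deg v + mdeg deg w = mdeg deg u \<Longrightarrow>
      b \<in> V v \<Longrightarrow> c \<in> W w \<Longrightarrow> b + c \<in> U"
  shows "conv cop f g u \<in> free_on U"
  unfolding conv_def
proof (rule free_on_lin_ext)
  fix p assume "p \<in> keys (cop (mon u))"
  then obtain v w where p: "p = (v, w)" "(v, w) \<in> keys (cop (mon u))" by (cases p) auto
  have "f v * g w \<in> free_on U"
    using cop_keys[OF assms(1) p(2)] by (intro free_on_mult[OF assms(2,3)] assms(4)) auto
  then show "(case p of (v, w) \<Rightarrow> f v * g w) \<in> free_on U" by (simp add: p)
qed

section \<open>Convolution powers of the identity\<close>

lemma id_power_zero: "id_power cop a 0 = 1"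
  by (induction a) (auto simp: id_power_Suc conv_zero conv_one_def mon_zero)

lemma id_power_1: "u \<in> S \<Longrightarrow> id_power cop 1 u = mon u"
  by (simp add: id_power_Suc conv_one_right)

lemma hopf_power_eq: "x \<in> poly_alg gens \<Longrightarrow> a \<ge> 1 \<Longrightarrow> hopf_power cop a x = lin_ext (id_power cop a) x"
proof -
  assume x: "x \<in> poly_alg gens" and a: "a \<ge> 1"
  \<comment> \<open>The iterate starts at the identity, itself the first convolution power, hence
    the shift of the exponent by one.\<close>
  have "(conv cop mon ^^ n) mon u = id_power cop (Suc n) u" if "u \<in> S" for n u
    using that
  proof (induction n arbitrary: u)
    case (Suc n)
    then show ?case
      by (simp add: id_power_Suc[of _ "Suc n"]) (intro conv_cop_cong, auto)
  qed (use id_power_1 in simp)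
  moreover obtain n where "a = Suc n" using a by (cases a) auto
  ultimately show ?thesis
    using x by (auto simp: hopf_power_def iter_mult_iter_cop poly_alg_def dest: free_onD
        intro!: lin_ext_cong)
qed

lemma id_power_homogeneous: "u \<in> S \<Longrightarrow> id_power cop a u \<in> free_on (H (mdeg deg u))"
proof (induction a arbitrary: u)
  case 0
  then show ?case by (auto simp: conv_one_def free_on_zero H_iff mon_zero[symmetric])
next
  case (Suc a)
  show ?case unfolding id_power_Suc
    by (rule conv_free_on[OF Suc.prems, of _ "\<lambda>v. {v}", OF _ Suc.IH])
      (auto simp: H_iff mdeg_add)
qed

lemma id_power_in_poly_alg: "u \<in> S \<Longrightarrow> id_power cop a u \<in> free_on S"
  by (rule free_on_mono[OF id_power_homogeneous]) (auto simp: H_iff)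

lemma id_power_mult:
  "u \<in> S \<Longrightarrow> v \<in> S \<Longrightarrow> id_power cop a (u + v) = id_power cop a u * id_power cop a v"
proof (induction a arbitrary: u v)
  case (Suc a)
  then show ?case unfolding id_power_Suc
    by (intro conv_add_multiplicative) (auto simp: mon_add)
qed (auto simp: conv_one_def)

lemma id_power_prod_mset:
  "b \<in> S \<Longrightarrow> id_power cop a b = (\<Prod>c\<in>#b. id_power cop a {#c#})"
proof (induction b)
  case (add c b)
  then have "{#c#} \<in> S" "b \<in> S" by (auto simp: monomials_def)
  with add id_power_mult[of "{#c#}" b] show ?case by simp
qed (simp add: id_power_zero)

lemma id_power_add: "u \<in> S \<Longrightarrow> id_power cop (a + c) u = conv cop (id_power cop a) (id_power cop c) u"
proof (induction a arbitrary: u)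
  case (Suc a)
  have "conv cop mon (id_power cop (a + c)) u =
      conv cop mon (conv cop (id_power cop a) (id_power cop c)) u"
    using Suc by (intro conv_cop_cong) auto
  with Suc.prems show ?case by (simp add: id_power_Suc conv_assoc)
qed (simp add: conv_one_left)

text \<open>\<open>\<Psi>\<^sup>a\<close> is multiplicative, and composing with an algebra
  endomorphism distributes over convolution.\<close>

lemma lin_ext_id_power_conv:
  assumes u: "u \<in> S" and "\<And>v. v \<in> S \<Longrightarrow> f v \<in> free_on S" "\<And>v. v \<in> S \<Longrightarrow> g v \<in> free_on S"
  shows "lin_ext (id_power cop a) (conv cop f g u) =
    conv cop (\<lambda>v. lin_ext (id_power cop a) (f v)) (\<lambda>w. lin_ext (id_power cop a) (g w)) u"
proof -
  have "lin_ext (id_power cop a) (f v * g w) =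
      lin_ext (id_power cop a) (f v) * lin_ext (id_power cop a) (g w)" if "v \<in> S" "w \<in> S" for v w
    using assms(2,3) that by (intro lin_ext_mult id_power_mult) (auto dest: free_onD)
  then show ?thesis
    using cop_keys[OF u] by (auto simp: conv_def lin_ext_lin_ext intro!: lin_ext_cong)
qed

text \<open>Composing \<open>\<Psi>\<^sup>a\<close> with the \<open>c\<close>-fold convolution power
  of the identity gives the \<open>c\<close>-fold convolution power of
  \<open>\<Psi>\<^sup>a\<close>, whose exponents add up to \<open>a * c\<close>.\<close>

lemma lin_ext_id_power_id_power:
  "u \<in> S \<Longrightarrow> lin_ext (id_power cop a) (id_power cop c u) = id_power cop (a * c) u"
proof (induction c arbitrary: u)
  case 0
  have "lin_ext (id_power cop a) 1 = 1"
    by (metis lin_ext_mon mon_zero id_power_zero)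
  then show ?case by (simp add: conv_one_def)
next
  case (Suc c)
  have "lin_ext (id_power cop a) (id_power cop (Suc c) u) =
      conv cop (id_power cop a) (\<lambda>w. lin_ext (id_power cop a) (id_power cop c w)) u"
    unfolding id_power_Suc
    by (subst lin_ext_id_power_conv) (use Suc.prems id_power_in_poly_alg in auto)
  also have "\<dots> = conv cop (id_power cop a) (id_power cop (a * c)) u"
    using Suc by (intro conv_cop_cong) auto
  finally show ?case using Suc.prems by (simp add: id_power_add)
qed

section \<open>Convolution powers of the augmentation projection\<close>

text \<open>\<open>aug\<close> kills the constant monomial, so each of the \<open>a\<close> factors
  contributes at least one generator.\<close>

lemma aug_power_free_on:
  "u \<in> S \<Longrightarrow> aug_power cop a u \<in> free_on {b \<in> H (mdeg deg u). size b \<ge> a}"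
proof (induction a arbitrary: u)
  case 0
  then show ?case by (auto simp: conv_one_def free_on_zero H_iff mon_zero[symmetric])
next
  case (Suc a)
  have aug: "aug v \<in> free_on {b \<in> H (mdeg deg v). size b \<ge> 1}" if "v \<in> S" for v
    using that by (auto simp: aug_def conv_one_def mon_zero free_on_zero H_iff Suc_le_eq
        nonempty_has_size[symmetric])
  show ?case unfolding aug_power_Suc
    by (rule conv_free_on[OF Suc.prems aug Suc.IH]) (auto simp: H_iff mdeg_add)
qed

lemma aug_power_eq_0: "u \<in> S \<Longrightarrow> a > mdeg deg u \<Longrightarrow> aug_power cop a u = 0"
proof -
  assume u: "u \<in> S" "a > mdeg deg u"
  have "{b \<in> H (mdeg deg u). size b \<ge> a} = {}"
    using u size_le_mdeg by (fastforce simp: H_iff)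
  with aug_power_free_on[OF u(1), of a] show ?thesis by (simp add: free_on_def)
qed

lemma conv_mon_eq: "u \<in> S \<Longrightarrow> conv cop mon f u = f u + conv cop aug f u"
  by (simp add: aug_def[abs_def] conv_diff_left conv_one_left)

lemma id_power_binomial_upto:
  "u \<in> S \<Longrightarrow> id_power cop a u = (\<Sum>i\<le>a. of_nat (a choose i) * aug_power cop i u)"
proof (induction a arbitrary: u)
  case (Suc a)
  let ?N = "aug_power cop"
  have "conv cop aug (id_power cop a) u =
      conv cop aug (\<lambda>w. \<Sum>i\<le>a. of_nat (a choose i) * ?N i w) u"
    using Suc by (intro conv_cop_cong) auto
  also have "\<dots> = (\<Sum>i\<le>a. of_nat (a choose i) * ?N (Suc i) u)"
    by (simp add: conv_sum_right conv_mult_right aug_power_Suc)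
  finally have "id_power cop (Suc a) u =
      (\<Sum>i\<le>a. of_nat (a choose i) * ?N i u) + (\<Sum>i\<le>a. of_nat (a choose i) * ?N (Suc i) u)"
    using Suc by (simp add: id_power_Suc conv_mon_eq)
  \<comment> \<open>The added term has coefficient \<open>a choose Suc a = 0\<close>; after the
    shift both sums combine by Pascal's rule.\<close>
  also have "(\<Sum>i\<le>a. of_nat (a choose i) * ?N i u) = (\<Sum>i\<le>Suc a. of_nat (a choose i) * ?N i u)"
    by (simp add: binomial_eq_0)
  also have "\<dots> = ?N 0 u + (\<Sum>i\<le>a. of_nat (a choose Suc i) * ?N (Suc i) u)"
    by (subst sum.atMost_Suc_shift) simp
  finally show ?case
    by (subst sum.atMost_Suc_shift) (simp add: sum.distrib algebra_simps)
qed simp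

text \<open>With a range independent of \<open>a\<close>, the right-hand side is a polynomial in
  \<open>a\<close>. It has no constant term because \<open>aug_power cop 0\<close> vanishes at
  \<open>u \<noteq> 0\<close>.\<close>

lemma id_power_binomial:
  assumes u: "u \<in> S" "u \<noteq> 0"
  shows "id_power cop a u = (\<Sum>i=1..mdeg deg u. of_nat (a choose i) * aug_power cop i u)"
proof -
  have 0: "aug_power cop 0 u = 0" using u by (simp add: conv_one_def)
  have "(\<Sum>i\<le>a. of_nat (a choose i) * aug_power cop i u) =
      (\<Sum>i=1..max a (mdeg deg u). of_nat (a choose i) * aug_power cop i u)"
    by (rule sum.mono_neutral_cong) (use 0 in \<open>auto simp: Suc_le_eq binomial_eq_0 intro: gr0I\<close>)
  also have "\<dots> = (\<Sum>i=1..mdeg deg u. of_nat (a choose i) * aug_power cop i u)"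
    by (rule sum.mono_neutral_right) (use u aug_power_eq_0 in auto)
  finally show ?thesis using id_power_binomial_upto[OF u(1)] by simp
qed

section \<open>The reduced coproduct and the Eulerian idempotent\<close>

lemma tensor_one_mon: "tensor 1 (mon u) = (mon (0, u) :: 'g multiset \<times> 'g multiset \<Rightarrow>\<^sub>0 'k)"
  and tensor_mon_one: "tensor (mon u) 1 = (mon (u, 0) :: 'g multiset \<times> 'g multiset \<Rightarrow>\<^sub>0 'k)"
  by (simp_all add: tensor_def mon_zero[symmetric])

text \<open>The counit on the left factor keeps exactly the terms \<open>(0, w)\<close>, so the
  counit axiom determines their coefficients.\<close>

lemma lookup_cop_left:
  assumes "u \<in> S"
  shows "lookup (cop (mon u)) (0, w) = lookup (mon u) w"
proof -
  have "lookup (mon u) w = lookup (form_left eps (cop (mon u))) w"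
    using assms by (simp add: counit_left mon_in_poly_alg)
  also have "\<dots> = (\<Sum>p\<in>keys (cop (mon u)). if p = (0, w) then lookup (cop (mon u)) p else 0)"
    unfolding form_left_def lin_ext_def lookup_sum using cop_keys[OF assms]
    by (intro sum.cong) (auto simp: eps_mon lookup_mon split: if_splits)
  finally show ?thesis by (simp add: in_keys_iff)
qed

lemma lookup_cop_right:
  assumes "u \<in> S"
  shows "lookup (cop (mon u)) (w, 0) = lookup (mon u) w"
proof -
  have "lookup (mon u) w = lookup (form_right eps (cop (mon u))) w"
    using assms by (simp add: counit_right mon_in_poly_alg)
  also have "\<dots> = (\<Sum>p\<in>keys (cop (mon u)). if p = (w, 0) then lookup (cop (mon u)) p else 0)"
    unfolding form_right_def lin_ext_def lookup_sum using cop_keys[OF assms]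
    by (intro sum.cong) (auto simp: eps_mon lookup_mon split: if_splits)
  finally show ?thesis by (simp add: in_keys_iff)
qed

text \<open>The two subtractions remove exactly the terms with a factor 1. For \<open>u = 0\<close>
  they would remove the same term twice, hence \<open>u \<noteq> 0\<close>.\<close>

lemma reduced_cop_keys:
  assumes u: "u \<in> S" "u \<noteq> 0" and vw: "(v, w) \<in> keys (reduced_cop cop (mon u))"
  shows "v \<in> S" "w \<in> S" "v \<noteq> 0" "w \<noteq> 0" "mdeg deg v + mdeg deg w = mdeg deg u"
proof -
  have red: "lookup (reduced_cop cop (mon u)) p =
      lookup (cop (mon u)) p - lookup (mon (0, u)) p - lookup (mon (u, 0)) p" for p
    by (simp add: reduced_cop_def lookup_minus tensor_one_mon tensor_mon_one)
  show nz: "v \<noteq> 0" "w \<noteq> 0"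
    using vw u by (auto simp: in_keys_iff red lookup_cop_left lookup_cop_right lookup_mon)
  then have "(v, w) \<in> keys (cop (mon u))"
    using vw u by (auto simp: in_keys_iff red lookup_mon)
  from cop_keys[OF u(1) this] show "v \<in> S" "w \<in> S" "mdeg deg v + mdeg deg w = mdeg deg u" .
qed

lemma conv_reduced_power:
  "u \<in> S \<Longrightarrow> u \<noteq> 0 \<Longrightarrow> (conv (reduced_cop cop) mon ^^ a) mon u = aug_power cop (Suc a) u"
proof (induction a arbitrary: u)
  case 0
  then show ?case by (simp add: aug_power_Suc conv_one_right) (simp add: aug_def conv_one_def)
next
  case (Suc a)
  have "aug_power cop (Suc a) 0 = 0"
    by (simp add: aug_power_Suc conv_zero aug_def conv_one_def mon_zero)
  moreover have "(conv (reduced_cop cop) mon ^^ Suc a) mon u =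
      conv (reduced_cop cop) mon (aug_power cop (Suc a)) u"
    using reduced_cop_keys(2,4)[OF Suc.prems] Suc.IH by (auto intro!: conv_cong)
  \<comment> \<open>Subtracting \<open>1 \<otimes> u\<close> replaces the left factor
    \<open>mon\<close> by \<open>aug\<close>; the term from \<open>u \<otimes> 1\<close> vanishes
    since the convolution power is 0 at the constant monomial.\<close>
  moreover have "conv (reduced_cop cop) mon g u = conv cop mon g u - g u - mon u * g 0" for g
    by (simp add: conv_def reduced_cop_def lin_ext_diff tensor_one_mon tensor_mon_one mon_zero)
  ultimately show ?case
    using Suc.prems by (simp add: conv_mon_eq aug_power_Suc[of _ "Suc a"])
qed

lemma iter_reduced_cop_free_on:
  assumes u: "u \<in> S" "u \<noteq> 0"
  shows "iter_cop (reduced_cop cop) (Suc a) (mon u) \<in>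
    free_on {w. length w = Suc a \<and> set w \<subseteq> S - {0} \<and> (\<Sum>v\<leftarrow>w. mdeg deg v) = mdeg deg u}"
proof (induction a)
  case 0
  then show ?case using u by simp
next
  case (Suc a)
  show ?case unfolding iter_cop.simps apply_last_def
  proof (intro free_on_lin_ext)
    fix w p
    assume "w \<in> keys (iter_cop (reduced_cop cop) (Suc a) (mon u))"
      and p: "p \<in> keys (reduced_cop cop (mon (last w)))"
    then have w: "length w = Suc a" "set w \<subseteq> S - {0}" "(\<Sum>v\<leftarrow>w. mdeg deg v) = mdeg deg u"
      using free_onD[OF Suc] by auto
    then have "w \<noteq> []" by auto
    then obtain xs x where xs: "w = xs @ [x]" by (metis append_butlast_last_id)
    obtain y z where yz: "p = (y, z)" by (cases p)
    with w p xs reduced_cop_keys[of x y z]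
    show "(case p of (y, z) \<Rightarrow> mon (butlast w @ [y, z])) \<in> free_on {w. length w = Suc (Suc a) \<and>
        set w \<subseteq> S - {0} \<and> (\<Sum>v\<leftarrow>w. mdeg deg v) = mdeg deg u}"
      by auto
  qed
qed

text \<open>Each of the \<open>a\<close> letters of a word has positive degree, so \<open>a\<close>
  cannot exceed the total. Vanishing is shown before multiplying out because the index set in
  \<open>eulerian\<close> refers to the iterated coproduct.\<close>

lemma iter_reduced_cop_eq_0:
  assumes u: "u \<in> S" "u \<noteq> 0" and a: "a > mdeg deg u"
  shows "iter_cop (reduced_cop cop) a (mon u) = 0"
proof -
  have "length w \<le> (\<Sum>v\<leftarrow>w. mdeg deg v)" if "set w \<subseteq> S - {0}" for w
    using that
  proof (induction w)
    case (Cons v w)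
    with mdeg_pos[of v] show ?case by simp
  qed simp
  moreover obtain c where "a = Suc c" using a by (cases a) auto
  ultimately have "{w. length w = Suc c \<and> set w \<subseteq> S - {0} \<and>
      (\<Sum>v\<leftarrow>w. mdeg deg v) = mdeg deg u} = {}" using a by fastforce
  with iter_reduced_cop_free_on[OF u, of c] \<open>a = Suc c\<close> show ?thesis
    by (simp add: free_on_def)
qed

text \<open>This is the logarithm series of the identity in the convolution algebra, cut off at the
  degree of \<open>u\<close>, beyond which all terms vanish.\<close>

lemma eulerian_mon:
  assumes u: "u \<in> S" "u \<noteq> 0"
  shows "eulerian cop (mon u) =
    (\<Sum>i=1..mdeg deg u. fscale ((-1) ^ (i - 1) / of_nat i) (aug_power cop i u))"
proof -
  let ?I = "{i. i \<ge> 1 \<and> iter_cop (reduced_cop cop) i (mon u) \<noteq> 0}"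
  let ?f = "\<lambda>i. iter_mult (iter_cop (reduced_cop cop) i (mon u))"
  have f: "?f i = aug_power cop i u" if "i \<ge> 1" for i
    using that u by (cases i) (simp_all add: iter_mult_iter_cop conv_reduced_power)
  have "eulerian cop (mon u) = (\<Sum>i\<in>?I. fscale ((-1) ^ (i - 1) / of_nat i) (?f i))"
    using u by (simp add: eulerian_def lookup_mon Let_def)
  also have "\<dots> = (\<Sum>i=1..mdeg deg u. fscale ((-1) ^ (i - 1) / of_nat i) (?f i))"
  proof (rule sum.mono_neutral_left)
    show "?I \<subseteq> {1..mdeg deg u}"
      using iter_reduced_cop_eq_0[OF u] by (auto simp: not_less[symmetric])
    show "\<forall>i\<in>{1..mdeg deg u} - ?I. fscale ((-1) ^ (i - 1) / of_nat i) (?f i) = 0"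
      by (auto simp: iter_mult_def)
  qed simp
  also have "\<dots> = (\<Sum>i=1..mdeg deg u. fscale ((-1) ^ (i - 1) / of_nat i) (aug_power cop i u))"
    using f by (intro sum.cong) auto
  finally show ?thesis .
qed

end

section \<open>Polynomials in the exponent\<close>

text \<open>Evaluation at a natural number only adds coefficients repeatedly, so it commutes with
  additive maps. It is applied to \<open>\<Psi>\<^sup>a\<close> and to taking one
  coefficient.\<close>

lemma poly_map_poly_additive:
  fixes \<phi> :: "'a::comm_ring_1 \<Rightarrow> 'b::comm_ring_1"
  assumes zero: "\<phi> 0 = 0" and add: "\<And>x y. \<phi> (x + y) = \<phi> x + \<phi> y"
  shows "poly (map_poly \<phi> p) (of_nat n) = \<phi> (poly p (of_nat n))"
proof -
  have of_nat: "\<phi> (of_nat n * x) = of_nat n * \<phi> x" for x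
    by (induction n) (simp_all add: zero add distrib_right)
  show ?thesis
    by (induction p) (simp_all add: map_poly_pCons zero add of_nat)
qed

text \<open>The coefficients at \<open>u\<close> form a polynomial over the field. If its values at
  all positive integers were 0, it would have infinitely many roots in characteristic zero.\<close>

lemma poly_mapping_poly_nonzero:
  fixes p :: "('m::comm_monoid_add \<Rightarrow>\<^sub>0 'k::field_char_0) poly"
  assumes "lookup (coeff p l) u \<noteq> 0"
  shows "\<exists>a\<ge>1. lookup (poly p (of_nat a)) u \<noteq> 0"
proof (rule ccontr)
  define q where "q = map_poly (\<lambda>x. lookup x u) p"
  assume "\<not> ?thesis"
  then have "poly q (of_nat a) = 0" if "a \<ge> 1" for a
    using that unfolding q_def
    by (subst poly_map_poly_additive) (auto simp: lookup_add)
  then have "of_nat ` {1..} \<subseteq> {x. poly q x = 0}" by auto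
  moreover have "infinite (of_nat ` {1..} :: 'k set)"
    by (subst finite_image_iff) (auto simp: inj_on_def infinite_Ici)
  ultimately have "q = 0" using poly_roots_finite finite_subset by blast
  then have "coeff q l = 0" by simp
  with assms show False by (simp add: q_def coeff_map_poly)
qed

lemma poly_mapping_poly_eqI:
  fixes p q :: "('m::comm_monoid_add \<Rightarrow>\<^sub>0 'k::field_char_0) poly"
  assumes "\<And>a. a \<ge> 1 \<Longrightarrow> poly p (of_nat a) = poly q (of_nat a)"
  shows "p = q"
proof (rule poly_eqI, rule poly_mapping_eqI)
  fix l u
  show "lookup (coeff p l) u = lookup (coeff q l) u"
  proof (rule ccontr)
    assume "lookup (coeff p l) u \<noteq> lookup (coeff q l) u"
    then have "\<exists>a\<ge>1. lookup (poly (p - q) (of_nat a)) u \<noteq> 0"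
      by (intro poly_mapping_poly_nonzero[of _ l]) (simp add: lookup_minus)
    with assms show False by auto
  qed
qed

text \<open>\<open>binomial_quotient i\<close> is the polynomial \<open>(X choose i) / X\<close>.\<close>

definition binomial_quotient :: "nat \<Rightarrow> 'k::field_char_0 poly" where
  "binomial_quotient i = smult (1 / fact i) (\<Prod>j=1..<i. [:- of_nat j, 1:])"

lemma poly_binomial_quotient:
  assumes "i \<ge> 1"
  shows "of_nat a * poly (binomial_quotient i) (of_nat a) = (of_nat (a choose i) :: 'k::field_char_0)"
proof -
  have "(of_nat (a choose i) :: 'k) = (\<Prod>j=0..<i. of_nat a - of_nat j) / fact i"
    by (simp add: binomial_gbinomial gbinomial_prod_rev)
  also have "(\<Prod>j=0..<i. of_nat a - of_nat j :: 'k) = of_nat a * (\<Prod>j=1..<i. of_nat a - of_nat j)"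
    using assms by (simp add: prod.atLeast_Suc_lessThan)
  finally show ?thesis by (simp add: binomial_quotient_def poly_prod)
qed

text \<open>The linear coefficient of \<open>a choose i\<close> in \<open>a\<close> is the
  coefficient of the logarithm series; this is how the Eulerian idempotent enters.\<close>

lemma coeff_0_binomial_quotient:
  assumes "i \<ge> 1"
  shows "coeff (binomial_quotient i) 0 = ((-1) ^ (i - 1) / of_nat i :: 'k::field_char_0)"
proof -
  have "(\<Prod>j=1..<Suc n. - of_nat j :: 'k) = (-1) ^ n * fact n" for n
    by (induction n) (simp_all add: algebra_simps)
  moreover have "coeff (binomial_quotient i) 0 = (1 / fact i) * (\<Prod>j=1..<i. - of_nat j :: 'k)"
    by (simp add: binomial_quotient_def poly_0_coeff_0[symmetric] poly_prod)
  moreover obtain n where n: "i = Suc n" using assms by (cases i) auto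
  ultimately have "coeff (binomial_quotient i) 0 = (1 / fact (Suc n)) * ((-1) ^ n * fact n :: 'k)"
    by (simp only:)
  then show ?thesis by (simp add: n field_simps del: of_nat_Suc)
qed

locale polynomial_hopf_algebra_char_0 = polynomial_hopf_algebra gens deg cop eps
  for gens :: "'g set" and deg :: "'g \<Rightarrow> nat"
    and cop :: "('g multiset \<Rightarrow>\<^sub>0 'k::field_char_0) \<Rightarrow> ('g multiset \<times> 'g multiset \<Rightarrow>\<^sub>0 'k)"
    and eps :: "('g multiset \<Rightarrow>\<^sub>0 'k) \<Rightarrow> 'k"
begin

text \<open>\<open>X * gen_poly c\<close> interpolates \<open>a \<mapsto> \<Psi>\<^sup>a(c)\<close>, and \<open>mon_poly b\<close> interpolates \<open>a \<mapsto> \<Psi>\<^sup>a(b)\<close>;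
  the coefficients are elements of the Hopf algebra.\<close>

definition gen_poly :: "'g \<Rightarrow> ('g multiset \<Rightarrow>\<^sub>0 'k) poly" where
  "gen_poly c = (\<Sum>i=1..deg c. map_poly (\<lambda>x. fscale x (aug_power cop i {#c#})) (binomial_quotient i))"

definition mon_poly :: "'g multiset \<Rightarrow> ('g multiset \<Rightarrow>\<^sub>0 'k) poly" where
  "mon_poly b = monom 1 (size b) * (\<Prod>c\<in>#b. gen_poly c)"

lemma single_in_S: "c \<in> gens \<Longrightarrow> {#c#} \<in> S"
  by (simp add: monomials_def)

lemma poly_gen_poly:
  assumes "c \<in> gens"
  shows "of_nat a * poly (gen_poly c) (of_nat a) = id_power cop a {#c#}"
proof -
  have "poly (map_poly (\<lambda>x. fscale x y) p) (of_nat a) = fscale (poly p (of_nat a)) y"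
    for y :: "'g multiset \<Rightarrow>\<^sub>0 'k" and p
  proof (induction p)
    case (pCons x p)
    then show ?case
      by (simp add: map_poly_pCons fmod.scale_left_distrib of_nat_mult_eq_fscale)
  qed simp
  then have "of_nat a * poly (gen_poly c) (of_nat a) = (\<Sum>i=1..deg c.
      fscale (of_nat a * poly (binomial_quotient i) (of_nat a)) (aug_power cop i {#c#}))"
    by (simp add: gen_poly_def poly_sum sum_distrib_left of_nat_mult_eq_fscale)
  also have "\<dots> = (\<Sum>i=1..deg c. of_nat (a choose i) * aug_power cop i {#c#})"
    by (intro sum.cong) (simp_all add: poly_binomial_quotient of_nat_mult_eq_fscale)
  finally have "of_nat a * poly (gen_poly c) (of_nat a) =
      (\<Sum>i=1..deg c. of_nat (a choose i) * aug_power cop i {#c#})" .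
  with assms show ?thesis by (simp add: id_power_binomial single_in_S mdeg_single)
qed

lemma coeff_0_gen_poly:
  assumes "c \<in> gens"
  shows "coeff (gen_poly c) 0 = eulerian cop (mon {#c#})"
proof -
  have "coeff (gen_poly c) 0 =
      (\<Sum>i=1..deg c. fscale (coeff (binomial_quotient i) 0) (aug_power cop i {#c#}))"
    by (simp add: gen_poly_def coeff_sum coeff_map_poly)
  also have "\<dots> = (\<Sum>i=1..deg c. fscale ((-1) ^ (i - 1) / of_nat i) (aug_power cop i {#c#}))"
    by (intro sum.cong) (simp_all add: coeff_0_binomial_quotient)
  finally show ?thesis using assms by (simp add: eulerian_mon single_in_S mdeg_single)
qed

lemma poly_mon_poly:
  assumes "b \<in> S"
  shows "poly (mon_poly b) (of_nat a) = id_power cop a b"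
proof -
  have "poly (mon_poly b) (of_nat a) = (\<Prod>c\<in>#b. of_nat a * poly (gen_poly c) (of_nat a))"
    by (simp add: mon_poly_def poly_monom poly_prod_mset prod_mset.distrib image_mset.compositionality
        o_def)
  also have "\<dots> = (\<Prod>c\<in>#b. id_power cop a {#c#})"
    using assms by (intro arg_cong[where f = prod_mset] image_mset_cong poly_gen_poly)
      (auto simp: monomials_def)
  finally show ?thesis using assms by (simp add: id_power_prod_mset)
qed

text \<open>\<open>g\<^sub>b\<close> is the lowest-order coefficient of the polynomial \<open>a \<mapsto> \<Psi>\<^sup>a(b)\<close>.\<close>

lemma coeff_mon_poly:
  assumes "b \<in> S"
  shows "coeff (mon_poly b) (size b) = eigen_monomial cop b"
proof -
  have "coeff (mon_poly b) (size b) = (\<Prod>c\<in>#b. coeff (gen_poly c) 0)"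
    by (simp add: mon_poly_def coeff_monom_mult poly_0_coeff_0[symmetric] poly_prod_mset
        image_mset.compositionality o_def)
  also have "\<dots> = eigen_monomial cop b"
    unfolding eigen_monomial_def using assms
    by (intro arg_cong[where f = prod_mset] image_mset_cong coeff_0_gen_poly)
      (auto simp: monomials_def)
  finally show ?thesis .
qed

section \<open>The eigenvectors\<close>

text \<open>Substituting \<open>a X\<close> for \<open>X\<close> in \<open>mon_poly b\<close> has
  the same effect as applying \<open>\<Psi>\<^sup>a\<close> to its coefficients, and it scales the
  coefficient of order \<open>size b\<close> by \<open>a ^ size b\<close>.\<close>

lemma lin_ext_id_power_eigen_monomial:
  assumes "b \<in> S" "a \<ge> 1"
  shows "lin_ext (id_power cop a) (eigen_monomial cop b) =
    fscale (of_nat a ^ size b) (eigen_monomial cop b)"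
proof -
  let ?\<Psi> = "lin_ext (id_power cop a)"
  have "map_poly ?\<Psi> (mon_poly b) = pcompose (mon_poly b) [:0, of_nat a:]"
  proof (rule poly_mapping_poly_eqI)
    fix c
    have "poly (map_poly ?\<Psi> (mon_poly b)) (of_nat c) = ?\<Psi> (poly (mon_poly b) (of_nat c))"
      by (rule poly_map_poly_additive) (simp_all add: lin_ext_add)
    also have "\<dots> = poly (mon_poly b) (of_nat (a * c))"
      using assms by (simp only: poly_mon_poly lin_ext_id_power_id_power)
    also have "\<dots> = poly (pcompose (mon_poly b) [:0, of_nat a:]) (of_nat c)"
      by (simp add: poly_pcompose mult.commute)
    finally show "poly (map_poly ?\<Psi> (mon_poly b)) (of_nat c) =
      poly (pcompose (mon_poly b) [:0, of_nat a:]) (of_nat c)" .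
  qed
  then have "coeff (map_poly ?\<Psi> (mon_poly b)) (size b) =
      coeff (pcompose (mon_poly b) [:0, of_nat a:]) (size b)" by simp
  with assms show ?thesis
    by (simp add: coeff_map_poly coeff_pcompose_linear coeff_mon_poly of_nat_power_mult_eq_fscale)
qed

lemma eigen_monomial_remainder:
  "b \<in> S \<Longrightarrow> eigen_monomial cop b - mon b \<in> free_on {c \<in> H (mdeg deg b). size c > size b}"
proof (induction b)
  case empty
  then show ?case by (simp add: eigen_monomial_def mon_zero free_on_zero)
next
  case (add x b)
  then have x: "x \<in> gens" and b: "b \<in> S" by (auto simp: monomials_def)
  let ?e = "eulerian cop (mon {#x#})" and ?g = "eigen_monomial cop b"
  let ?F = "\<lambda>b. free_on {c \<in> H (mdeg deg b). size c > size b}"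
  have e: "?e - mon {#x#} \<in> ?F {#x#}"
  proof -
    \<comment> \<open>The term \<open>i = 1\<close> is the generator itself; the later ones have
      length at least 2.\<close>
    have "?e = aug_power cop 1 {#x#} + (\<Sum>i=2..deg x. fscale ((-1) ^ (i - 1) / of_nat i) (aug_power cop i {#x#}))"
      using deg_pos[OF x] x
      by (simp add: eulerian_mon single_in_S mdeg_single sum.atLeast_Suc_atMost numeral_2_eq_2)
    moreover have "aug_power cop 1 {#x#} = mon {#x#}"
      using x by (simp add: aug_power_Suc conv_one_right single_in_S) (simp add: aug_def conv_one_def)
    moreover have "(\<Sum>i=2..deg x. fscale ((-1) ^ (i - 1) / of_nat i) (aug_power cop i {#x#})) \<in> ?F {#x#}"
      by (intro free_on_sum free_on_fscale free_on_mono[OF aug_power_free_on[OF single_in_S[OF x]]])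
        auto
    ultimately show ?thesis by simp
  qed
  have "mon {#x#} \<in> free_on {c \<in> H (mdeg deg {#x#}). size c \<ge> 1}"
    using x by (simp add: H_iff single_in_S)
  then have "(?e - mon {#x#}) + mon {#x#} \<in> free_on {c \<in> H (mdeg deg {#x#}). size c \<ge> 1}"
    by (intro free_on_add free_on_mono[OF e]) auto
  then have e1: "?e \<in> free_on {c \<in> H (mdeg deg {#x#}). size c \<ge> 1}" by simp
  have mon_add_mset: "mon (add_mset x b) = (mon {#x#} * mon b :: 'g multiset \<Rightarrow>\<^sub>0 'k)"
    using mon_add[of "{#x#}" b] by simp
  \<comment> \<open>Telescoping: in each summand one factor exceeds its leading length and the other
    has at least its own.\<close>
  have "eigen_monomial cop (add_mset x b) - mon (add_mset x b) =
      (?g - mon b) * ?e + mon b * (?e - mon {#x#})"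
    by (simp add: mon_add_mset eigen_monomial_def algebra_simps)
  also have "\<dots> \<in> ?F (add_mset x b)"
  proof (rule free_on_add)
    show "(?g - mon b) * ?e \<in> ?F (add_mset x b)"
      by (rule free_on_mult[OF add.IH[OF b] e1]) (auto simp: H_iff mdeg_def)
    show "mon b * (?e - mon {#x#}) \<in> ?F (add_mset x b)"
      by (rule free_on_mult[of _ "{b}", OF _ e]) (use b in \<open>auto simp: H_iff mdeg_def\<close>)
  qed
  finally show ?case .
qed

lemma unitriangular_eigen_monomial: "unitriangular_family (H n) size (eigen_monomial cop)"
  by unfold_locales (use finite_H eigen_monomial_remainder in \<open>auto simp: H_iff\<close>)

lemma eigen_monomial_in_H: "b \<in> H n \<Longrightarrow> eigen_monomial cop b \<in> free_on (H n)"
  by (rule unitriangular_family.in_free_on[OF unitriangular_eigen_monomial])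

lemma poly_alg_deg_subset: "poly_alg_deg gens deg n \<subseteq> (poly_alg gens :: ('g multiset \<Rightarrow>\<^sub>0 'k) set)"
  by (auto simp: poly_alg_deg_def poly_alg_def H_iff elim!: free_on_mono)

section \<open>Coefficients of the eigenvectors and the relation \<open>leads_to\<close>\<close>

lemma lookup_eigen_monomial_self: "b \<in> S \<Longrightarrow> lookup (eigen_monomial cop b) b = 1"
  using unitriangular_family.lookup_eq[OF unitriangular_eigen_monomial, of b "mdeg deg b" b]
  by (simp add: H_iff)

lemma lookup_eigen_monomial_size:
  "b \<in> S \<Longrightarrow> c \<in> keys (eigen_monomial cop b) \<Longrightarrow> c \<noteq> b \<Longrightarrow> size c > size b"
  using unitriangular_family.lookup_eq[OF unitriangular_eigen_monomial, of b "mdeg deg b" c]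
  by (auto simp: H_iff in_keys_iff not_le[symmetric])

lemma keys_eigen_monomial: "b \<in> S \<Longrightarrow> c \<in> keys (eigen_monomial cop b) \<Longrightarrow> c \<in> S"
  using free_onD[OF eigen_monomial_in_H, of b "mdeg deg b" c] by (simp add: H_iff)

lemma leads_to_iff: "b \<in> S \<Longrightarrow> leads_to cop b c \<longleftrightarrow> (\<exists>a\<ge>1. lookup (id_power cop a b) c \<noteq> 0)"
  by (simp add: leads_to_def hopf_power_eq mon_in_poly_alg cong: conj_cong)

lemma leads_to_if_lookup:
  "b \<in> S \<Longrightarrow> lookup (eigen_monomial cop b) c \<noteq> 0 \<Longrightarrow> leads_to cop b c"
  using poly_mapping_poly_nonzero[of "mon_poly b" "size b" c]
  by (simp add: leads_to_iff coeff_mon_poly poly_mon_poly)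

text \<open>Every \<open>\<Psi>\<^sup>a\<close> preserves degree, so all monomials reached from
  \<open>b\<close> lie in one finite set.\<close>

lemma finite_leads_to: "b \<in> S \<Longrightarrow> finite {c \<in> S. leads_to cop b c}"
  using free_onD[OF id_power_homogeneous, of b]
  by (intro finite_subset[OF _ finite_H[of "mdeg deg b"]]) (auto simp: leads_to_iff in_keys_iff)

text \<open>Common source of the two expansions in the theorem, which differ only in the index set
  \<open>T\<close>.\<close>

lemma eigen_monomial_expansion:
  assumes "b \<in> S" "finite T" "b \<notin> T" "keys (eigen_monomial cop b) \<subseteq> insert b T"
  shows "eigen_monomial cop b = mon b + (\<Sum>c\<in>T. fscale (lookup (eigen_monomial cop b) c) (mon c))"
proof -
  have "eigen_monomial cop b = lin_ext mon (eigen_monomial cop b)"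
    by (simp add: lin_ext_mon_self)
  also have "\<dots> = (\<Sum>c\<in>insert b T. fscale (lookup (eigen_monomial cop b) c) (mon c))"
    using assms by (intro lin_ext_superset) auto
  finally show ?thesis using assms by (simp add: lookup_eigen_monomial_self)
qed

lemma eigenvector_eigen_monomial:
  assumes "b \<in> H n" "a \<ge> 1"
  shows "eigenvector (poly_alg_deg gens deg n) (hopf_power cop a) (of_nat a ^ size b)
    (eigen_monomial cop b)"
proof -
  have b: "b \<in> S" using assms(1) by (simp add: H_iff)
  have mem: "eigen_monomial cop b \<in> poly_alg_deg gens deg n"
    using eigen_monomial_in_H[OF assms(1)] by (simp add: poly_alg_deg_def)
  with poly_alg_deg_subset have "eigen_monomial cop b \<in> poly_alg gens" by blast
  then have "hopf_power cop a (eigen_monomial cop b) =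
      fscale (of_nat a ^ size b) (eigen_monomial cop b)"
    using assms b by (simp add: hopf_power_eq lin_ext_id_power_eigen_monomial)
  moreover have "eigen_monomial cop b \<noteq> 0"
    using lookup_eigen_monomial_self[OF b] by auto
  ultimately show ?thesis using mem by (simp add: eigenvector_def eigenspace_def)
qed

text \<open>For \<open>a \<ge> 2\<close> the powers of \<open>of_nat a\<close> are distinct in
  characteristic zero; for \<open>a = 1\<close> all eigenvalues coincide.\<close>

lemma dim_eigenspace_hopf_power:
  assumes "a \<ge> 2"
  shows "fmod.dim (eigenspace (poly_alg_deg gens deg n) (hopf_power cop a) (of_nat a ^ l)) =
    card {b \<in> H n. size b = l}"
proof -
  interpret unitriangular_family "H n" size "eigen_monomial cop"
    by (rule unitriangular_eigen_monomial)
  have "eigenspace (poly_alg_deg gens deg n) (hopf_power cop a) (of_nat a ^ l) =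
      eigenspace (free_on (H n)) (lin_ext (id_power cop a)) (of_nat a ^ l)"
    using assms poly_alg_deg_subset[of n]
    by (auto simp: eigenspace_def poly_alg_deg_def hopf_power_eq subset_iff)
  moreover have "inj (\<lambda>n. (of_nat a :: 'k) ^ n)"
    using assms by (auto simp: inj_on_def simp flip: of_nat_power)
  moreover have "lin_ext (id_power cop a) (eigen_monomial cop b) =
      fscale (of_nat a ^ size b) (eigen_monomial cop b)" if "b \<in> H n" for b
    using that assms by (simp add: lin_ext_id_power_eigen_monomial H_iff)
  ultimately show ?thesis using dim_eigenspace by simp
qed

end

section \<open>Counting monomials\<close>

lemma finite_monomials_deg:
  assumes "finite G" "\<And>c. c \<in> G \<Longrightarrow> deg c > 0"
  shows "finite (monomials_deg G deg n)"
proof (rule finite_subset)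
  show "monomials_deg G deg n \<subseteq> (\<Union>k\<le>n. {b. set_mset b \<subseteq> G \<and> size b = k})"
  proof
    fix b assume "b \<in> monomials_deg G deg n"
    then have "set_mset b \<subseteq> G" "mdeg deg b = n" by (auto simp: monomials_deg_def monomials_def)
    with size_le_mdeg_if_pos[of b deg] assms(2)
    show "b \<in> (\<Union>k\<le>n. {b. set_mset b \<subseteq> G \<and> size b = k})" by auto
  qed
  show "finite (\<Union>k\<le>n. {b. set_mset b \<subseteq> G \<and> size b = k})"
    using finite_multisets_of_size[OF assms(1)] by (simp add: multisets_of_size_def)
qed

definition monomial_count :: "'g set \<Rightarrow> ('g \<Rightarrow> nat) \<Rightarrow> rat fps fps" where
  "monomial_count G deg =
    Abs_fps (\<lambda>n. Abs_fps (\<lambda>l. of_nat (card {b \<in> monomials_deg G deg n. size b = l})))"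

lemma monomial_count_nth:
  "fps_nth (fps_nth (monomial_count G deg) n) l =
    of_nat (card {b \<in> monomials_deg G deg n. size b = l})"
  by (simp add: monomial_count_def)

text \<open>The inverse of the geometric series that counts the powers of one generator of degree
  \<open>i\<close> when \<open>i > 0\<close>.\<close>

definition gen_factor :: "nat \<Rightarrow> rat fps fps" where
  "gen_factor i = 1 - fps_const fps_X * fps_X ^ i"

lemma monomial_count_empty: "monomial_count {} deg = 1"
proof -
  have "{b \<in> monomials_deg {} deg n. size b = l} = (if n = 0 \<and> l = 0 then {{#}} else {})" for n l
    by (auto simp: monomials_deg_def monomials_def mdeg_def)
  then show ?thesis
    by (intro fps_ext) (simp add: monomial_count_nth)
qed

text \<open>A monomial in \<open>insert c G\<close> either avoids \<open>c\<close> or is \<open>c\<close> times another one.\<close>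

lemma card_monomials_insert:
  assumes "finite G" "c \<notin> G" "\<And>x. x \<in> insert c G \<Longrightarrow> deg x > 0"
  shows "card {b \<in> monomials_deg (insert c G) deg n. size b = l} =
    card {b \<in> monomials_deg G deg n. size b = l} +
    (if deg c \<le> n \<and> l > 0 then
      card {b \<in> monomials_deg (insert c G) deg (n - deg c). size b = l - 1} else 0)"
proof -
  let ?A = "{b \<in> monomials_deg (insert c G) deg n. size b = l}"
  let ?B = "{b \<in> monomials_deg G deg n. size b = l}"
  let ?C = "{b \<in> monomials_deg (insert c G) deg (n - deg c). size b = l - 1}"
  have fin: "finite ?A" using finite_monomials_deg[of "insert c G" deg n] assms by simp
  have B: "?B = {b \<in> ?A. c \<notin># b}"
    using assms(2) by (auto simp: monomials_deg_def monomials_def)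
  have C: "{b \<in> ?A. c \<in># b} = (if deg c \<le> n \<and> l > 0 then add_mset c ` ?C else {})"
  proof (cases "deg c \<le> n \<and> l > 0")
    case True
    have "b \<in> add_mset c ` ?C" if b: "b \<in> ?A" "c \<in># b" for b
    proof -
      obtain b' where b': "b = add_mset c b'" using b(2) by (metis mset_add)
      with b True show ?thesis by (auto simp: monomials_deg_def monomials_def)
    qed
    with True show ?thesis by (auto simp: monomials_deg_def monomials_def)
  next
    case False
    have "\<not> (b \<in> ?A \<and> c \<in># b)" for b
    proof
      assume b: "b \<in> ?A \<and> c \<in># b"
      then obtain b' where "b = add_mset c b'" by (metis mset_add)
      with b False show False by (auto simp: monomials_deg_def)
    qed
    with False show ?thesis by auto
  qed
  have "?A = {b \<in> ?A. c \<notin># b} \<union> {b \<in> ?A. c \<in># b}" by blast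
  also have "card \<dots> = card {b \<in> ?A. c \<notin># b} + card {b \<in> ?A. c \<in># b}"
    by (intro card_Un_disjoint finite_subset[OF _ fin]) auto
  finally show ?thesis by (simp only: B C) (simp add: card_image inj_on_def)
qed

text \<open>Multiplication by \<open>y x^(deg c)\<close> counts the monomials divisible by
  \<open>c\<close>; subtracting these leaves the ones that avoid \<open>c\<close>.\<close>

lemma monomial_count_insert:
  assumes "finite G" "c \<notin> G" "\<And>x. x \<in> insert c G \<Longrightarrow> deg x > 0"
  shows "gen_factor (deg c) * monomial_count (insert c G) deg = monomial_count G deg"
proof (intro fps_ext)
  fix n l
  have eq: "fps_const fps_X * fps_X ^ deg c * monomial_count (insert c G) deg =
      fps_X ^ deg c * (fps_const fps_X * monomial_count (insert c G) deg)"
    by (simp add: mult_ac)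
  have "fps_nth (fps_nth (fps_const fps_X * fps_X ^ deg c * monomial_count (insert c G) deg) n) l =
      (if deg c \<le> n \<and> l > 0 then
        of_nat (card {b \<in> monomials_deg (insert c G) deg (n - deg c). size b = l - 1}) else 0)"
    unfolding eq by (simp add: fps_X_power_mult_nth monomial_count_nth)
  then show "fps_nth (fps_nth (gen_factor (deg c) * monomial_count (insert c G) deg) n) l =
      fps_nth (fps_nth (monomial_count G deg) n) l"
    using card_monomials_insert[where n = n and l = l, OF assms]
    by (simp add: gen_factor_def left_diff_distrib monomial_count_nth)
qed

lemma monomial_count_prod:
  assumes "finite G" "\<And>x. x \<in> G \<Longrightarrow> deg x > 0"
  shows "(\<Prod>c\<in>G. gen_factor (deg c)) * monomial_count G deg = 1"
  using assms
proof (induction G)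
  case empty
  then show ?case by (simp add: monomial_count_empty)
next
  case (insert c G)
  have "(\<Prod>x\<in>insert c G. gen_factor (deg x)) * monomial_count (insert c G) deg =
      (\<Prod>x\<in>G. gen_factor (deg x)) * (gen_factor (deg c) * monomial_count (insert c G) deg)"
    using insert by (simp add: mult_ac)
  also have "\<dots> = 1" using insert by (subst monomial_count_insert) auto
  finally show ?case .
qed

section \<open>The infinite product over all degrees\<close>

lemma gen_factor_power_inverse:
  assumes "i > 0"
  shows "gen_factor i ^ d * inverse (gen_factor i ^ d) = 1"
proof -
  \<comment> \<open>The coefficient ring \<open>rat fps\<close> is not a field, so invertibility is
    read off from the constant coefficient, which is 1 as \<open>i > 0\<close>.\<close>
  have "fps_nth (gen_factor i) 0 = 1"
    using assms by (cases i) (simp_all add: gen_factor_def)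
  then have "fps_nth (gen_factor i ^ d) 0 = 1"
    by (rule fps_power_zeroth_eq_one)
  then show ?thesis
    unfolding fps_inverse_def by (intro fps_right_inverse) simp
qed

text \<open>Grouping the generators by degree reduces this to the finite product. Index
  \<open>i\<close> stands for degree \<open>Suc i\<close>, hence the bound
  \<open>Suc n\<close>.\<close>

lemma prod_inverse_gen_factor:
  assumes fin: "\<And>i. finite {c \<in> gens. deg c = i}" and pos: "\<And>c. c \<in> gens \<Longrightarrow> deg c > 0"
  shows "(\<Prod>i\<le>n. inverse (gen_factor (Suc i) ^ num_gens gens deg (Suc i))) =
    monomial_count {c \<in> gens. deg c \<le> Suc n} deg"
proof -
  let ?G = "{c \<in> gens. deg c \<le> Suc n}"
  let ?f = "\<lambda>i. gen_factor (Suc i) ^ num_gens gens deg (Suc i)"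
  have "?G = (\<Union>i\<le>n. {c \<in> gens. deg c = Suc i})"
  proof (intro equalityI subsetI)
    fix c assume "c \<in> ?G"
    with pos[of c] show "c \<in> (\<Union>i\<le>n. {c \<in> gens. deg c = Suc i})"
      by (intro UN_I[of "deg c - 1"]) auto
  qed auto
  moreover have "(\<Prod>c\<in>(\<Union>i\<le>n. {c \<in> gens. deg c = Suc i}). gen_factor (deg c)) =
      (\<Prod>i\<le>n. \<Prod>c\<in>{c \<in> gens. deg c = Suc i}. gen_factor (deg c))"
    using fin by (intro prod.UNION_disjoint) auto
  ultimately have "(\<Prod>c\<in>?G. gen_factor (deg c)) = (\<Prod>i\<le>n. ?f i)"
    by (simp add: num_gens_def)
  moreover have "finite ?G"
  proof -
    have "?G = (\<Union>i\<le>Suc n. {c \<in> gens. deg c = i})" by auto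
    then show ?thesis using fin by simp
  qed
  ultimately have *: "(\<Prod>i\<le>n. ?f i) * monomial_count ?G deg = 1"
    using monomial_count_prod[of ?G deg] pos by auto
  have **: "(\<Prod>i\<le>n. inverse (?f i)) * (\<Prod>i\<le>n. ?f i) = 1"
    by (simp add: prod.distrib[symmetric] mult.commute[of "inverse _"] gen_factor_power_inverse)
  have "(\<Prod>i\<le>n. inverse (?f i)) =
      (\<Prod>i\<le>n. inverse (?f i)) * ((\<Prod>i\<le>n. ?f i) * monomial_count ?G deg)"
    by (simp only: * mult_1_right)
  also have "\<dots> = ((\<Prod>i\<le>n. inverse (?f i)) * (\<Prod>i\<le>n. ?f i)) * monomial_count ?G deg"
    by (rule mult.assoc[symmetric])
  also have "\<dots> = monomial_count ?G deg" by (simp only: ** mult_1_left)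
  finally show ?thesis .
qed

text \<open>A monomial of degree \<open>m\<close> involves only generators of degree at most
  \<open>m\<close>, so the coefficient of order \<open>m\<close> is constant from the
  \<open>m\<close>-th partial product on.\<close>

lemma gen_product_eq:
  assumes fin: "\<And>i. finite {c \<in> gens. deg c = i}" and pos: "\<And>c. c \<in> gens \<Longrightarrow> deg c > 0"
  shows "gen_product (num_gens gens deg) = monomial_count gens deg"
proof -
  let ?f = "\<lambda>i. inverse (gen_factor (Suc i) ^ num_gens gens deg (Suc i))"
  have deg_le: "deg c \<le> mdeg deg b" if "c \<in># b" for b c
    using that by (metis le_add1 mdeg_add_mset mset_add)
  have nth: "fps_nth (monomial_count {c \<in> gens. deg c \<le> Suc n} deg) m =
      fps_nth (monomial_count gens deg) m" if "m \<le> n" for n m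
  proof -
    have "monomials_deg {c \<in> gens. deg c \<le> Suc n} deg m = monomials_deg gens deg m"
      using that deg_le by (fastforce simp: monomials_deg_def monomials_def)
    then show ?thesis by (simp add: monomial_count_def)
  qed
  have "(\<lambda>n. \<Prod>i\<le>n. ?f i) \<longlonglongrightarrow> monomial_count gens deg"
    unfolding tendsto_fps_iff
  proof
    fix m
    have "eventually (\<lambda>n. n \<ge> m) sequentially" by (rule eventually_ge_at_top)
    then show "eventually (\<lambda>n. fps_nth (\<Prod>i\<le>n. ?f i) m = fps_nth (monomial_count gens deg) m)
        sequentially"
      by eventually_elim (subst prod_inverse_gen_factor[OF fin pos], use nth in auto)
  qed
  \<comment> \<open>\<open>has_prod\<close> demands a nonzero limit; the empty monomial provides a
    nonzero coefficient.\<close>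
  moreover have "{b \<in> monomials_deg gens deg 0. size b = 0} = {{#}}"
    by (auto simp: monomials_deg_def monomials_def mdeg_def)
  then have "fps_nth (fps_nth (monomial_count gens deg) 0) 0 = 1"
    by (simp add: monomial_count_nth)
  then have "monomial_count gens deg \<noteq> 0" by auto
  ultimately have "?f has_prod monomial_count gens deg"
    unfolding has_prod_def raw_has_prod_def by simp
  then show ?thesis
    unfolding gen_product_def gen_factor_def by (rule has_prod_unique[symmetric])
qed

section \<open>Eigenbasis, expansions and multiplicities\<close>

theorem theorem3p14:
  fixes gens :: "'g set"
    and deg :: "'g \<Rightarrow> nat"
    and cop :: "('g multiset \<Rightarrow>\<^sub>0 'k::field_char_0) \<Rightarrow> ('g multiset \<times> 'g multiset \<Rightarrow>\<^sub>0 'k)"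
    and eps :: "('g multiset \<Rightarrow>\<^sub>0 'k) \<Rightarrow> 'k"
  assumes "polynomial_hopf_algebra gens deg cop eps"
  shows
    "(\<forall>b\<in>monomials gens. \<forall>a\<ge>1.
        eigenvector (poly_alg gens) (hopf_power cop a) (of_nat a ^ size b) (eigen_monomial cop b)) \<and>
     (\<forall>b\<in>monomials gens.
        finite {b' \<in> monomials gens. leads_to cop b b'} \<and>
        eigen_monomial cop b =
          mon b + (\<Sum>b'\<in>{b' \<in> monomials gens. leads_to cop b b' \<and> b' \<noteq> b}.
                     fscale (Poly_Mapping.lookup (eigen_monomial cop b) b') (mon b')) \<and>
        eigen_monomial cop b =
          mon b + (\<Sum>b'\<in>{b' \<in> monomials gens. size b' > size b \<and>
                                Poly_Mapping.lookup (eigen_monomial cop b) b' \<noteq> 0}.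
                     fscale (Poly_Mapping.lookup (eigen_monomial cop b) b') (mon b'))) \<and>
     (\<forall>n.
        inj_on (eigen_monomial cop) (monomials_deg gens deg n) \<and>
        fmod.independent (eigen_monomial cop ` monomials_deg gens deg n) \<and>
        fmod.span (eigen_monomial cop ` monomials_deg gens deg n) = poly_alg_deg gens deg n \<and>
        (\<forall>b\<in>monomials_deg gens deg n. \<forall>a\<ge>1.
           eigenvector (poly_alg_deg gens deg n) (hopf_power cop a) (of_nat a ^ size b)
             (eigen_monomial cop b))) \<and>
     (\<forall>n l.
        of_nat (card {b \<in> monomials_deg gens deg n. size b = l}) =
          fps_nth (fps_nth (gen_product (num_gens gens deg)) n) l \<and>
        (\<forall>a\<ge>2.
           of_nat (fmod.dim (eigenspace (poly_alg_deg gens deg n) (hopf_power cop a) (of_nat a ^ l))) =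
             fps_nth (fps_nth (gen_product (num_gens gens deg)) n) l))"
proof -
  interpret polynomial_hopf_algebra_char_0 gens deg cop eps
    using assms by (rule polynomial_hopf_algebra_char_0.intro)
  \<comment> \<open>Generators of degree \<open>i\<close> are among the finitely many monomials of
    degree \<open>i\<close>.\<close>
  have fin: "finite {c \<in> gens. deg c = i}" for i
  proof (rule finite_imageD)
    show "finite ((\<lambda>c. {#c#}) ` {c \<in> gens. deg c = i})"
      by (rule finite_subset[OF _ finite_H[of i]]) (auto simp: H_iff single_in_S mdeg_single)
  qed (simp add: inj_on_def)
  have expansions: "finite {b' \<in> S. leads_to cop b b'}"
    "eigen_monomial cop b = mon b + (\<Sum>b'\<in>{b' \<in> S. leads_to cop b b' \<and> b' \<noteq> b}.
      fscale (lookup (eigen_monomial cop b) b') (mon b'))"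
    "eigen_monomial cop b = mon b + (\<Sum>b'\<in>{b' \<in> S. size b' > size b \<and>
        lookup (eigen_monomial cop b) b' \<noteq> 0}.
      fscale (lookup (eigen_monomial cop b) b') (mon b'))" if b: "b \<in> S" for b
  proof -
    show fin: "finite {b' \<in> S. leads_to cop b b'}" by (rule finite_leads_to[OF b])
    show "eigen_monomial cop b = mon b + (\<Sum>b'\<in>{b' \<in> S. leads_to cop b b' \<and> b' \<noteq> b}.
      fscale (lookup (eigen_monomial cop b) b') (mon b'))"
    proof (rule eigen_monomial_expansion[OF b])
      show "finite {b' \<in> S. leads_to cop b b' \<and> b' \<noteq> b}"
        by (rule finite_subset[OF _ fin]) auto
      show "keys (eigen_monomial cop b) \<subseteq> insert b {b' \<in> S. leads_to cop b b' \<and> b' \<noteq> b}"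
        using keys_eigen_monomial[OF b] leads_to_if_lookup[OF b] by (auto simp: in_keys_iff)
    qed simp
    show "eigen_monomial cop b = mon b + (\<Sum>b'\<in>{b' \<in> S. size b' > size b \<and>
        lookup (eigen_monomial cop b) b' \<noteq> 0}.
      fscale (lookup (eigen_monomial cop b) b') (mon b'))"
    proof (rule eigen_monomial_expansion[OF b])
      show "finite {b' \<in> S. size b' > size b \<and> lookup (eigen_monomial cop b) b' \<noteq> 0}"
        by (rule finite_subset[of _ "keys (eigen_monomial cop b)"]) (auto simp: in_keys_iff)
      show "keys (eigen_monomial cop b) \<subseteq>
          insert b {b' \<in> S. size b' > size b \<and> lookup (eigen_monomial cop b) b' \<noteq> 0}"
        using keys_eigen_monomial[OF b] lookup_eigen_monomial_size[OF b] by (auto simp: in_keys_iff)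
    qed simp
  qed
  have eigen: "eigenvector (poly_alg gens) (hopf_power cop a) (of_nat a ^ size b) (eigen_monomial cop b)"
    if "b \<in> S" "a \<ge> 1" for b a
    using eigenvector_eigen_monomial[of b "mdeg deg b" a] that poly_alg_deg_subset
    by (auto simp: eigenvector_def eigenspace_def H_iff)
  have basis: "inj_on (eigen_monomial cop) (H n)"
    "fmod.independent (eigen_monomial cop ` H n)"
    "fmod.span (eigen_monomial cop ` H n) = poly_alg_deg gens deg n" for n
  proof -
    interpret unitriangular_family "H n" size "eigen_monomial cop"
      by (rule unitriangular_eigen_monomial)
    show "inj_on (eigen_monomial cop) (H n)" "fmod.independent (eigen_monomial cop ` H n)"
      "fmod.span (eigen_monomial cop ` H n) = poly_alg_deg gens deg n"
      by (rule inj independent)+ (simp add: span_eq poly_alg_deg_def)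
  qed
  have dim: "of_nat (fmod.dim (eigenspace (poly_alg_deg gens deg n) (hopf_power cop a) (of_nat a ^ l))) =
      fps_nth (fps_nth (gen_product (num_gens gens deg)) n) l" if "a \<ge> 2" for a n l
    using that
    by (simp add: dim_eigenspace_hopf_power gen_product_eq[OF fin deg_pos] monomial_count_nth)
  have count: "of_nat (card {b \<in> H n. size b = l}) =
      fps_nth (fps_nth (gen_product (num_gens gens deg)) n) l" for n l
    by (simp add: gen_product_eq[OF fin deg_pos] monomial_count_nth)
  show ?thesis
    by (intro conjI ballI allI impI)
      (fact expansions eigen basis eigenvector_eigen_monomial dim count)+
qed

end
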